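(* Let $n \geq 2$ be an integer and let $$f_n = (x_1 + \cdots + x_n)^2 - (x_1^2 + \cdots + x_n^2) = \sum_{1 \le i < j \le n} 2x_ix_j \in \mathbb{R}[x_1,\ldots,x_n].$$ Let $a \in \mathbb{R}^n$ be such that $f_n(a) = 0$. Then $$\operatorname{RLCT}_a(f_n)=\begin{cases} (1,2) & \text{if } a = 0 \text{ and } n = 2,\\ (1,1) & \text{otherwise.}\end{cases}$$
   Context: Real log canonical threshold. Let $p$ be a real-valued function, not identically zero near $a$, that is real analytic on a neighborhood of a point $a \in \mathbb{R}^d$, with $p(a) = 0$. For an open neighborhood $W$ of $a$ with compact closure on which $p$ is analytic, and for $\varepsilon>0$, put $T_p(\varepsilon) = \{w \in W : |p(w)| \le \varepsilon\}$ and let $\operatorname{vol}$ denote $d$-dimensional Lebesgue measure. It is known that if $W$ is chosen small enough, there are $C>0$, $\lambda \in \mathbb{Q}_{>0}$ and $m \in \{1,\ldots,d\}$ such that $\operatorname{vol} T_p(\varepsilon)$ is asymptotically equal to $C \cdot \varepsilon^{\lambda}(-\log \varepsilon)^{m-1}$ as $\varepsilon \to 0$ (the quotient tends to $1$), and the pair $(\lambda,m)$ does not depend on the choice of the sufficiently small $W$ (there is a $W$ such that all open neighborhoods $W' \subseteq W$ of $a$ give the same pair $(\lambda,m)$). One writes $\operatorname{RLCT}_a(p) = (\lambda,m)$. Equivalently, for $W$ small enough, the zeta function $\zeta_{p,a}(z) = \int_W |p(w)|^{-z}\,dw$ continues uniquely to a meromorphic function on $\mathbb{C}$ all of whose poles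 are positive rational numbers; $\lambda$ is its smallest pole and $m$ is the order of that pole. *)

theory Defs
  imports "HOL-Analysis.Analysis" "HOL-Real_Asymp.Real_Asymp"
begin

section \<open>Real analytic functions of several variables\<close>

text \<open>
  Real analyticity at \<open>b\<close>: \<open>p\<close> is the sum of a multivariate power series around \<open>b\<close>.
  The index type \<open>'n \<Rightarrow> nat\<close> is the set of multi-indices, and \<open>has_sum\<close> over it is
  unconditional (hence absolute) convergence.
\<close>

definition real_analytic_at :: "(real ^ 'n \<Rightarrow> real) \<Rightarrow> real ^ 'n \<Rightarrow> bool" where
  "real_analytic_at p b \<longleftrightarrow>
     (\<exists>(c :: ('n \<Rightarrow> nat) \<Rightarrow> real) r. r > 0 \<and>
        (\<forall>x \<in> ball b r.
           ((\<lambda>\<alpha>. c \<alpha> * (\<Prod>i\<in>UNIV. (x $ i - b $ i) ^ \<alpha> i)) has_sum p x) UNIV))"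

section \<open>The real log canonical threshold\<close>

definition sublevel_volume :: "(real ^ 'n \<Rightarrow> real) \<Rightarrow> (real ^ 'n) set \<Rightarrow> real \<Rightarrow> real" where
  "sublevel_volume p W \<epsilon> = measure lebesgue {w \<in> W. \<bar>p w\<bar> \<le> \<epsilon>}"

definition volume_pair :: "(real ^ 'n \<Rightarrow> real) \<Rightarrow> (real ^ 'n) set \<Rightarrow> real \<times> nat \<Rightarrow> bool" where
  "volume_pair p W = (\<lambda>(l, m). l \<in> \<rat> \<and> l > 0 \<and> m \<in> {1..CARD('n)} \<and>
     (\<exists>C>0. sublevel_volume p W \<sim>[at_right 0] (\<lambda>\<epsilon>. C * \<epsilon> powr l * (- ln \<epsilon>) ^ (m - 1))))"

definition analytic_nbhd :: "(real ^ 'n \<Rightarrow> real) \<Rightarrow> real ^ 'n \<Rightarrow> (real ^ 'n) set \<Rightarrow> bool" where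
  "analytic_nbhd p a W \<longleftrightarrow>
     open W \<and> a \<in> W \<and> compact (closure W) \<and> (\<forall>b\<in>W. real_analytic_at p b)"

text \<open>
  \<open>has_RLCT p a (l, m)\<close> expresses that the real log canonical threshold of \<open>p\<close> at \<open>a\<close>
  exists and equals \<open>(l, m)\<close>.

  One cannot ask that \<^emph>\<open>every\<close> open \<open>W' \<subseteq> W\<close> containing \<open>a\<close> have a volume function
  asymptotic to some \<open>C * \<epsilon> powr l * (- ln \<epsilon>) ^ (m - 1)\<close>.  For \<open>p (x, y) = y\<close> at the origin, let
  \<open>W'\<close> be the union of a tiny disc around the origin and of the points \<open>(x, y)\<close> of \<open>W\<close> with \<open>x\<close> in
  some interval away from that disc and \<open>\<bar>y\<bar>\<close> in one of the intervals between \<open>1/2^(2k+1)\<close> and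
  \<open>1/2^(2k)\<close>: the volume divided by \<open>\<epsilon>\<close> then oscillates.  So independence of the neighbourhood
  reads: \<open>W\<close> itself has the pair \<open>(l, m)\<close>, neighbourhoods with the pair \<open>(l, m)\<close> exist inside every
  \<open>W'\<close>, and every \<open>W'\<close> whose volume function has such an asymptotic form has the same pair.
  For the remaining \<open>W'\<close> the volume is still of the exact order given by \<open>(l, m)\<close>,
  see \<open>has_RLCT_bigtheta\<close> below.
\<close>

definition has_RLCT :: "(real ^ 'n \<Rightarrow> real) \<Rightarrow> real ^ 'n \<Rightarrow> real \<times> nat \<Rightarrow> bool" where
  "has_RLCT p a lm \<longleftrightarrow>
     p a = 0 \<and> (\<exists>\<^sub>F w in nhds a. p w \<noteq> 0) \<and>
     (\<exists>W. analytic_nbhd p a W \<and> volume_pair p W lm \<and>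
        (\<forall>W'. open W' \<and> a \<in> W' \<and> W' \<subseteq> W \<longrightarrow>
           (\<exists>V. open V \<and> a \<in> V \<and> V \<subseteq> W' \<and> volume_pair p V lm) \<and>
           (\<forall>lm'. volume_pair p W' lm' \<longrightarrow> lm' = lm)))"

lemma has_RLCT_unique:
  assumes "has_RLCT p a lm" "has_RLCT p a lm'"
  shows "lm = lm'"
proof -
  obtain W where W: "analytic_nbhd p a W"
    and sub: "\<forall>W'. open W' \<and> a \<in> W' \<and> W' \<subseteq> W \<longrightarrow>
       (\<exists>V. open V \<and> a \<in> V \<and> V \<subseteq> W' \<and> volume_pair p V lm) \<and>
       (\<forall>k. volume_pair p W' k \<longrightarrow> k = lm)"
    using assms(1) unfolding has_RLCT_def by (elim conjE exE)
  obtain W2 where W2: "analytic_nbhd p a W2"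
    and sub2: "\<forall>W'. open W' \<and> a \<in> W' \<and> W' \<subseteq> W2 \<longrightarrow>
       (\<exists>V. open V \<and> a \<in> V \<and> V \<subseteq> W' \<and> volume_pair p V lm') \<and>
       (\<forall>k. volume_pair p W' k \<longrightarrow> k = lm')"
    using assms(2) unfolding has_RLCT_def by (elim conjE exE)
  have "open (W \<inter> W2) \<and> a \<in> W \<inter> W2 \<and> W \<inter> W2 \<subseteq> W"
    using W W2 by (auto simp: analytic_nbhd_def)
  from sub[rule_format, OF this] obtain V
    where V: "open V" "a \<in> V" "V \<subseteq> W \<inter> W2" "volume_pair p V lm"
    by (elim conjE exE)
  have "open V \<and> a \<in> V \<and> V \<subseteq> W2" using V by simp
  from conjunct2[OF sub2[rule_format, OF this]] have "volume_pair p V lm \<longrightarrow> lm = lm'" ..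
  with V(4) show ?thesis by (rule rev_mp)
qed

lemma real_analytic_at_isCont:
  fixes p :: "real ^ 'n \<Rightarrow> real"
  assumes "real_analytic_at p b"
  shows "isCont p b"
proof -
  obtain c :: "('n \<Rightarrow> nat) \<Rightarrow> real" and r where r: "r > 0"
    and hs: "\<And>x. x \<in> ball b r \<Longrightarrow>
      ((\<lambda>\<alpha>. c \<alpha> * (\<Prod>i\<in>UNIV. (x $ i - b $ i) ^ \<alpha> i)) has_sum p x) UNIV"
    using assms unfolding real_analytic_at_def by blast
  define s where "s = r / (2 * real CARD('n))"
  have s: "s > 0" using r by (simp add: s_def)
  define y where "y = b + (\<chi> i. s)"
  have "norm (\<chi> i::'n. s) \<le> (\<Sum>i\<in>(UNIV::'n set). \<bar>s\<bar>)"
    using norm_le_l1_cart[of "\<chi> i::'n. s"] by simp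
  also have "\<dots> < r" using s r by (simp add: s_def)
  finally have "y \<in> ball b r" by (simp add: y_def dist_norm)
  from hs[OF this] have "(\<lambda>\<alpha>. c \<alpha> * (\<Prod>i\<in>UNIV. s ^ \<alpha> i)) summable_on UNIV"
    by (auto simp: y_def summable_on_def)
  then have "(\<lambda>\<alpha>. \<bar>c \<alpha> * (\<Prod>i\<in>UNIV. s ^ \<alpha> i)\<bar>) summable_on UNIV"
    using summable_on_iff_abs_summable_on_real by fastforce
  then obtain M where "((\<lambda>\<alpha>. \<bar>c \<alpha> * (\<Prod>i\<in>UNIV. s ^ \<alpha> i)\<bar>) has_sum M) UNIV"
    by (auto simp: summable_on_def)
  then have M: "((\<lambda>\<alpha>. \<bar>c \<alpha>\<bar> * (\<Prod>i\<in>UNIV. s ^ \<alpha> i)) has_sum M) UNIV"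
    using s by (simp add: abs_mult abs_prod)
  let ?z = "\<lambda>_::'n. 0::nat"
  have z: "(\<Prod>i\<in>UNIV. (0::real) ^ \<alpha> i) = (if \<alpha> = ?z then 1 else 0)" for \<alpha> :: "'n \<Rightarrow> nat"
  proof (cases "\<alpha> = ?z")
    case False
    then obtain i where "\<alpha> i \<noteq> 0" by auto
    then have "(\<Prod>i\<in>UNIV. (0::real) ^ \<alpha> i) = 0"
      by (intro prod_zero) auto
    with False show ?thesis by simp
  qed simp
  have e: "((\<lambda>\<alpha>. c \<alpha> * (\<Prod>i\<in>UNIV. (0::real) ^ \<alpha> i)) has_sum p b) UNIV"
    using hs[of b] r by simp
  have bound: "\<bar>p x - p b\<bar> \<le> t * M"
    if x: "x \<in> ball b r" "\<And>i. \<bar>x $ i - b $ i\<bar> \<le> t * s" and t: "0 \<le> t" "t \<le> 1" for x t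
  proof -
    have d: "((\<lambda>\<alpha>. c \<alpha> * (\<Prod>i\<in>UNIV. (x $ i - b $ i) ^ \<alpha> i)
        - c \<alpha> * (\<Prod>i\<in>UNIV. 0 ^ \<alpha> i)) has_sum (p x - p b)) UNIV"
      using has_sum_add[OF hs[OF x(1)] e[THEN has_sum_uminusI]] by simp
    have "norm (p x - p b) \<le> t * M"
    proof (rule norm_infsum_le[OF d has_sum_cmult_right[OF M]])
      fix \<alpha> :: "'n \<Rightarrow> nat"
      show "norm (c \<alpha> * (\<Prod>i\<in>UNIV. (x $ i - b $ i) ^ \<alpha> i) - c \<alpha> * (\<Prod>i\<in>UNIV. 0 ^ \<alpha> i))
        \<le> t * (\<bar>c \<alpha>\<bar> * (\<Prod>i\<in>UNIV. s ^ \<alpha> i))"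
      proof (cases "\<alpha> = ?z")
        case True
        then show ?thesis using t by simp
      next
        case False
        then obtain j where j: "\<alpha> j \<noteq> 0" by auto
        have "(\<Prod>i\<in>UNIV. \<bar>x $ i - b $ i\<bar> ^ \<alpha> i) \<le> (\<Prod>i\<in>UNIV. (t * s) ^ \<alpha> i)"
          by (intro prod_mono conjI power_mono x) auto
        also have "\<dots> = (\<Prod>i\<in>UNIV. t ^ \<alpha> i) * (\<Prod>i\<in>UNIV. s ^ \<alpha> i)"
          by (simp add: power_mult_distrib prod.distrib)
        also have "(\<Prod>i\<in>UNIV. t ^ \<alpha> i) = t ^ \<alpha> j * (\<Prod>i\<in>UNIV - {j}. t ^ \<alpha> i)"
          by (simp add: prod.remove[of UNIV j])
        also have "\<dots> \<le> t * 1"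
        proof (intro mult_mono prod_le_1 prod_nonneg)
          show "t ^ \<alpha> j \<le> t" using j t power_decreasing[of 1 "\<alpha> j" t] by simp
        qed (use t in \<open>auto simp: power_le_one\<close>)
        finally have "(\<Prod>i\<in>UNIV. \<bar>x $ i - b $ i\<bar> ^ \<alpha> i) \<le> t * (\<Prod>i\<in>UNIV. s ^ \<alpha> i)"
          using s by (simp add: mult_right_mono prod_nonneg)
        then have "\<bar>c \<alpha>\<bar> * (\<Prod>i\<in>UNIV. \<bar>x $ i - b $ i\<bar> ^ \<alpha> i) \<le> \<bar>c \<alpha>\<bar> * (t * (\<Prod>i\<in>UNIV. s ^ \<alpha> i))"
          by (intro mult_left_mono) auto
        moreover have "(\<Prod>i\<in>UNIV. (0::real) ^ \<alpha> i) = 0" using False z[of \<alpha>] by presburger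
        ultimately show ?thesis
          by (simp only: mult_zero_right diff_zero real_norm_def abs_mult abs_prod power_abs
              mult.left_commute[of t])
      qed
    qed
    then show ?thesis by simp
  qed
  have "((\<lambda>x. p x - p b) \<longlongrightarrow> 0) (at b)"
  proof (rule Lim_null_comparison)
    have "\<forall>\<^sub>F x in at b. dist x b < min r s"
      unfolding eventually_at using r s by (intro exI[of _ "min r s"]) auto
    then show "\<forall>\<^sub>F x in at b. norm (p x - p b) \<le> dist x b / s * M"
    proof eventually_elim
      case (elim x)
      have "\<bar>x $ i - b $ i\<bar> \<le> dist x b / s * s" for i
        using component_le_norm_cart[of "x - b" i] s by (simp add: dist_norm)
      then show ?case
        using bound[of x "dist x b / s"] elim s by (simp add: dist_commute)
    qed
    have "((\<lambda>x. dist x b / s * M) \<longlongrightarrow> dist b b / s * M) (at b)"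
      using s by (intro tendsto_intros) auto
    then show "((\<lambda>x. dist x b / s * M) \<longlongrightarrow> 0) (at b)" by simp
  qed
  then show ?thesis by (simp add: isCont_def LIM_zero_iff)
qed

lemma sublevel_fmeasurable:
  assumes "analytic_nbhd p a W" "open V" "V \<subseteq> W"
  shows "{w \<in> V. \<bar>p w\<bar> \<le> \<epsilon>} \<in> fmeasurable lebesgue"
proof -
  have "continuous_on V p"
    using assms by (auto intro!: continuous_at_imp_continuous_on real_analytic_at_isCont
        simp: analytic_nbhd_def)
  then have "openin (top_of_set V) (V \<inter> (\<lambda>w. \<bar>p w\<bar>) -` {\<epsilon><..})"
    by (intro continuous_openin_preimage_gen continuous_intros) auto
  then have o: "open (V \<inter> (\<lambda>w. \<bar>p w\<bar>) -` {\<epsilon><..})"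
    using assms(2) openin_open_trans by blast
  have eq: "{w \<in> V. \<bar>p w\<bar> \<le> \<epsilon>} = V - (V \<inter> (\<lambda>w. \<bar>p w\<bar>) -` {\<epsilon><..})" by auto
  have "{w \<in> V. \<bar>p w\<bar> \<le> \<epsilon>} \<in> sets lebesgue"
    unfolding eq using o assms(2) by (intro sets.Diff) auto
  moreover have "bounded {w \<in> V. \<bar>p w\<bar> \<le> \<epsilon>}"
    using assms by (auto simp: analytic_nbhd_def dest!: compact_imp_bounded
        intro: bounded_subset closure_subset)
  ultimately show ?thesis
    by (intro bounded_set_imp_lmeasurable)
qed

lemma volume_pair_bigtheta:
  assumes "volume_pair p W (l, m)"
  shows "sublevel_volume p W \<in> \<Theta>[at_right 0](\<lambda>\<epsilon>. \<epsilon> powr l * (- ln \<epsilon>) ^ (m - 1))"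
proof -
  obtain C where C: "C > 0"
    "sublevel_volume p W \<sim>[at_right 0] (\<lambda>\<epsilon>. C * \<epsilon> powr l * (- ln \<epsilon>) ^ (m - 1))"
    using assms by (auto simp: volume_pair_def)
  from asymp_equiv_imp_bigtheta[OF C(2)] C(1) show ?thesis
    by (simp add: mult.assoc)
qed

lemma has_RLCT_bigtheta:
  assumes "has_RLCT p a (l, m)"
  shows "\<exists>W. analytic_nbhd p a W \<and>
    (\<forall>W'. open W' \<and> a \<in> W' \<and> W' \<subseteq> W \<longrightarrow>
      sublevel_volume p W' \<in> \<Theta>[at_right 0](\<lambda>\<epsilon>. \<epsilon> powr l * (- ln \<epsilon>) ^ (m - 1)))"
proof -
  obtain W where W: "analytic_nbhd p a W" "volume_pair p W (l, m)"
    and sub: "\<forall>W'. open W' \<and> a \<in> W' \<and> W' \<subseteq> W \<longrightarrow>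
       (\<exists>V. open V \<and> a \<in> V \<and> V \<subseteq> W' \<and> volume_pair p V (l, m)) \<and>
       (\<forall>k. volume_pair p W' k \<longrightarrow> k = (l, m))"
    using assms unfolding has_RLCT_def by (elim conjE exE)
  have mono: "sublevel_volume p U \<in> O[at_right 0](sublevel_volume p U')"
    if "open U" "open U'" "U \<subseteq> U'" "U' \<subseteq> W" for U U'
  proof (rule landau_o.big_mono, rule always_eventually, rule allI)
    fix \<epsilon>
    have "sublevel_volume p U \<epsilon> \<le> sublevel_volume p U' \<epsilon>"
      unfolding sublevel_volume_def
      using that sublevel_fmeasurable[OF W(1), of U \<epsilon>] sublevel_fmeasurable[OF W(1), of U' \<epsilon>]
      by (intro measure_mono_fmeasurable) auto
    then show "norm (sublevel_volume p U \<epsilon>) \<le> norm (sublevel_volume p U' \<epsilon>)"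
      by (simp add: sublevel_volume_def)
  qed
  have "sublevel_volume p W' \<in> \<Theta>[at_right 0](\<lambda>\<epsilon>. \<epsilon> powr l * (- ln \<epsilon>) ^ (m - 1))"
    if W': "open W'" "a \<in> W'" "W' \<subseteq> W" for W'
  proof -
    obtain V where V: "open V" "a \<in> V" "V \<subseteq> W'" "volume_pair p V (l, m)"
      using conjunct1[OF sub[rule_format, of W']] W' by auto
    have "open W" using W(1) by (simp add: analytic_nbhd_def)
    have 1: "sublevel_volume p W' \<in> O[at_right 0](\<lambda>\<epsilon>. \<epsilon> powr l * (- ln \<epsilon>) ^ (m - 1))"
      using mono[OF W'(1) \<open>open W\<close> W'(3) order_refl] volume_pair_bigtheta[OF W(2)]
      by (meson bigthetaD1 landau_o.big_trans)
    have 2: "(\<lambda>\<epsilon>. \<epsilon> powr l * (- ln \<epsilon>) ^ (m - 1)) \<in> O[at_right 0](sublevel_volume p W')"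
      using mono[OF V(1) W'(1) V(3) W'(3)] volume_pair_bigtheta[OF V(4)]
      by (meson bigthetaD2 bigomega_iff_bigo landau_o.big_trans)
    show ?thesis using 1 2 by (intro bigthetaI) (simp_all add: bigomega_iff_bigo)
  qed
  with W(1) show ?thesis by blast
qed

section \<open>The quadratic form\<close>

definition fpoly :: "real ^ 'n \<Rightarrow> real" where
  "fpoly x = (\<Sum>i\<in>UNIV. x $ i)\<^sup>2 - (\<Sum>i\<in>UNIV. (x $ i)\<^sup>2)"

lemma fpoly_eq_sum_less:
  fixes x :: "real ^ ('n :: {finite, linorder})"
  shows "fpoly x = (\<Sum>(i, j) \<in> {(i, j). i < j}. 2 * x $ i * x $ j)"
proof -
  let ?g = "\<lambda>(i, j). x $ i * x $ j"
  let ?L = "{(i :: 'n, j). i < j}" and ?G = "{(i :: 'n, j). j < i}" and ?D = "{(i :: 'n, j). i = j}"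
  have "(\<Sum>i\<in>UNIV. x $ i)\<^sup>2 = sum ?g (UNIV \<times> UNIV)"
    by (simp add: power2_eq_square sum_product sum.cartesian_product)
  also have "UNIV \<times> UNIV = (?L \<union> ?G) \<union> ?D" by auto
  also have "sum ?g \<dots> = sum ?g (?L \<union> ?G) + sum ?g ?D"
    by (rule sum.union_disjoint) auto
  also have "sum ?g (?L \<union> ?G) = sum ?g ?L + sum ?g ?G"
    by (rule sum.union_disjoint) auto
  also have "sum ?g ?G = sum ?g ?L"
    by (rule sum.reindex_bij_witness[of _ prod.swap prod.swap]) auto
  also have "sum ?g ?D = (\<Sum>i\<in>UNIV. (x $ i)\<^sup>2)"
    by (rule sum.reindex_bij_witness[of _ "\<lambda>i. (i, i)" fst]) (auto simp: power2_eq_square)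
  finally have "fpoly x = 2 * sum ?g ?L" by (simp add: fpoly_def)
  also have "\<dots> = (\<Sum>(i, j) \<in> ?L. 2 * x $ i * x $ j)"
    by (simp add: sum_distrib_left case_prod_unfold mult.assoc)
  finally show ?thesis .
qed

end

theory Submission imports Defs begin

text \<open>
  The volume of a sublevel set near \<open>a\<close> is computed by Cavalieri's principle, cutting along lines on
  which the form \<open>f\<close> is a polynomial of degree one or two.  The result does not depend on the
  neighbourhood because volumes are monotone: it is enough to treat one conveniently shaped
  neighbourhood inside every ball (\<open>has_RLCT_if_arbitrarily_small\<close>).

  If \<open>a \<noteq> 0\<close>, the gradient of \<open>f\<close> at \<open>a\<close> is nonzero since \<open>f\<close> is nondegenerate.  As \<open>f\<close> is affine
  in each coordinate \<open>x\<^sub>i\<close>, with slope \<open>L\<close> depending on the other coordinates only, a line in a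
  direction with \<open>L \<noteq> 0\<close> meets the set \<open>\<bar>f\<bar> \<le> \<epsilon>\<close> in an interval of length \<open>2 * \<epsilon> / \<bar>L\<bar>\<close>, and
  the volume is a constant multiple of \<open>\<epsilon>\<close> (\<open>small_volume_pair_fpoly_nonzero\<close>).

  If \<open>a = 0\<close>, the lines in direction \<open>(1, \<dots>, 1)\<close> are used.  A volume-preserving shear makes them
  parallel to an axis, and there \<open>f\<close> becomes \<open>c * (t + b)\<^sup>2 - q y\<close> with \<open>q\<close> positive definite in
  \<open>n - 1\<close> variables.  The line through \<open>y\<close> meets the sublevel set in a set of length at most a constant
  times \<open>\<epsilon> / sqrt (q y)\<close>, and asymptotic to such a multiple.  For \<open>n \<ge> 3\<close> the function
  \<open>1 / sqrt (q y)\<close> is integrable near \<open>0\<close>, and dominated convergence gives a volume asymptotic to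
  \<open>C * \<epsilon>\<close> (\<open>small_volume_pair_fpoly_zero\<close>).  For \<open>n = 2\<close> it is not, and this is the source of
  the exceptional logarithm: for \<open>2 * x * y\<close> in a square the volume is explicitly
  \<open>2 * \<epsilon> * (1 + ln (2 * r\<^sup>2) - ln \<epsilon>)\<close> (\<open>small_volume_pair_fpoly_zero_plane\<close>).
\<close>

section \<open>Reduction to one neighbourhood in every ball\<close>

text \<open>
  A power of \<open>\<epsilon>\<close> beats every power of the logarithm, so a bound between two such scales
  forces the lexicographic order of the pairs of exponents.
\<close>

lemma powr_log_bigo_imp:
  fixes l l' :: real and k k' :: nat
  assumes "(\<lambda>\<epsilon>. \<epsilon> powr l * (- ln \<epsilon>) ^ k) \<in> O[at_right 0](\<lambda>\<epsilon>. \<epsilon> powr l' * (- ln \<epsilon>) ^ k')"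
  shows "l' < l \<or> l' = l \<and> k \<le> k'"
proof (rule ccontr)
  assume "\<not> ?thesis"
  then have "l < l' \<or> l = l' \<and> k' < k" by auto
  then have "(\<lambda>\<epsilon>. \<epsilon> powr l' * (- ln \<epsilon>) ^ k') \<in> o[at_right 0](\<lambda>\<epsilon>. \<epsilon> powr l * (- ln \<epsilon>) ^ k)"
  proof
    assume "l < l'"
    then show ?thesis by real_asymp
  next
    assume *: "l = l' \<and> k' < k"
    then have "real k' < real k" by simp
    then have "(\<lambda>\<epsilon>. \<epsilon> powr l * (- ln \<epsilon>) powr real k') \<in> o[at_right 0](\<lambda>\<epsilon>. \<epsilon> powr l * (- ln \<epsilon>) powr real k)"
      by real_asymp
    also have "?this \<longleftrightarrow> ?thesis"
    proof (rule landau_o.small.cong_ex)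
      have "\<forall>\<^sub>F \<epsilon> in at_right 0. - ln \<epsilon> > (0::real)" by real_asymp
      then show "\<forall>\<^sub>F \<epsilon> in at_right 0. \<epsilon> powr l * (- ln \<epsilon>) powr real k' = \<epsilon> powr l' * (- ln \<epsilon>) ^ k'"
         "\<forall>\<^sub>F \<epsilon> in at_right 0. \<epsilon> powr l * (- ln \<epsilon>) powr real k = \<epsilon> powr l * (- ln \<epsilon>) ^ k"
        using * by (auto elim!: eventually_mono simp: powr_realpow)
    qed
    finally show ?thesis .
  qed
  moreover have "\<forall>\<^sub>F \<epsilon>::real in at_right 0. \<epsilon> powr l * (- ln \<epsilon>) ^ k \<noteq> 0"
  proof -
    have "\<forall>\<^sub>F \<epsilon>::real in at_right 0. - ln \<epsilon> > 0 \<and> \<epsilon> > 0" by (intro eventually_conj) real_asymp+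
    then show ?thesis by eventually_elim auto
  qed
  moreover note landau_o.small_big_asymmetric[OF calculation(1) assms]
  ultimately have "\<forall>\<^sub>F \<epsilon>::real in at_right 0. \<epsilon> powr l * (- ln \<epsilon>) ^ k \<noteq> 0 \<and> \<epsilon> powr l' * (- ln \<epsilon>) ^ k' = 0"
    by (simp add: eventually_conj_iff)
  moreover have "\<forall>\<^sub>F \<epsilon>::real in at_right 0. - ln \<epsilon> > 0 \<and> \<epsilon> > 0"
    by (intro eventually_conj) real_asymp+
  ultimately have "\<forall>\<^sub>F \<epsilon>::real in at_right 0. False"
    by eventually_elim auto
  then show False by simp
qed

text \<open>
  Sublevel volumes are monotone in the neighbourhood, so a neighbourhood squeezed between two
  neighbourhoods with the pair \<open>lm\<close> has a volume of that exact order and cannot have another pair.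
\<close>

lemma volume_pair_sandwich:
  fixes p :: "real ^ 'n \<Rightarrow> real"
  assumes W: "analytic_nbhd p a W" and W': "open W'" "W' \<subseteq> W" and V: "open V" "V \<subseteq> W'"
    and "volume_pair p W lm" "volume_pair p V lm" "volume_pair p W' lm'"
  shows "lm' = lm"
proof -
  obtain l m l' m' where lm: "lm = (l, m)" "lm' = (l', m')" by fastforce
  have m: "m \<ge> 1" "m' \<ge> 1" using assms by (auto simp: volume_pair_def lm)
  have mono: "sublevel_volume p U \<in> O[at_right 0](sublevel_volume p U')"
    if "open U" "open U'" "U \<subseteq> U'" "U' \<subseteq> W" for U U'
  proof (rule landau_o.big_mono, rule always_eventually, rule allI)
    fix \<epsilon>
    have "sublevel_volume p U \<epsilon> \<le> sublevel_volume p U' \<epsilon>"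
      unfolding sublevel_volume_def
      using that sublevel_fmeasurable[OF W, of U \<epsilon>] sublevel_fmeasurable[OF W, of U' \<epsilon>]
      by (intro measure_mono_fmeasurable) auto
    then show "norm (sublevel_volume p U \<epsilon>) \<le> norm (sublevel_volume p U' \<epsilon>)"
      by (simp add: sublevel_volume_def)
  qed
  let ?g = "\<lambda>l m \<epsilon>. \<epsilon> powr l * (- ln \<epsilon>) ^ (m - 1) :: real"
  have Th: "sublevel_volume p V \<in> \<Theta>[at_right 0](?g l m)" "sublevel_volume p W \<in> \<Theta>[at_right 0](?g l m)"
    "sublevel_volume p W' \<in> \<Theta>[at_right 0](?g l' m')"
    using assms(6-8) by (simp_all only: lm volume_pair_bigtheta)
  have "open W" using W by (simp add: analytic_nbhd_def)
  have VW': "?g l m \<in> O[at_right 0](?g l' m')"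
    using Th(1,3) mono[OF V(1) W'(1) V(2) W'(2)]
    by (meson bigthetaD1 bigthetaD2 bigomega_iff_bigo landau_o.big_trans)
  have W'W: "?g l' m' \<in> O[at_right 0](?g l m)"
    using Th(2,3) mono[OF W'(1) \<open>open W\<close> W'(2) order_refl]
    by (meson bigthetaD1 bigthetaD2 bigomega_iff_bigo landau_o.big_trans)
  show ?thesis
    using powr_log_bigo_imp[OF VW'] powr_log_bigo_imp[OF W'W] m by (auto simp: lm)
qed

text \<open>
  By the sandwich argument, the whole dependence on the neighbourhood in the definition of the
  threshold reduces to finding one good neighbourhood inside every ball.  These may have any
  convenient shape, which is what the explicit computations below exploit.
\<close>

lemma has_RLCT_if_arbitrarily_small:
  fixes p :: "real ^ 'n \<Rightarrow> real"
  assumes "p a = 0" "\<exists>\<^sub>F w in nhds a. p w \<noteq> 0" "\<And>b. real_analytic_at p b"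
    and small: "\<And>e. e > 0 \<Longrightarrow> \<exists>V. open V \<and> a \<in> V \<and> V \<subseteq> ball a e \<and> volume_pair p V lm"
  shows "has_RLCT p a lm"
proof -
  obtain W where W: "open W" "a \<in> W" "W \<subseteq> ball a 1" "volume_pair p W lm"
    using small[of 1] by auto
  have nW: "analytic_nbhd p a W"
    using W assms(3) bounded_subset[OF bounded_ball W(3)] by (auto simp: analytic_nbhd_def)
  have "(\<exists>V. open V \<and> a \<in> V \<and> V \<subseteq> W' \<and> volume_pair p V lm) \<and>
        (\<forall>lm'. volume_pair p W' lm' \<longrightarrow> lm' = lm)"
    if W': "open W'" "a \<in> W'" "W' \<subseteq> W" for W'
  proof -
    obtain e where "e > 0" "ball a e \<subseteq> W'" using W' open_contains_ball by blast
    with small[of e] obtain V where V: "open V" "a \<in> V" "V \<subseteq> W'" "volume_pair p V lm"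
      by blast
    with volume_pair_sandwich[OF nW W'(1,3) V(1,3) W(4) V(4)] show ?thesis by blast
  qed
  with nW W assms(1,2) show ?thesis unfolding has_RLCT_def by blast
qed

section \<open>Analyticity and non-vanishing of the form\<close>

lemma real_analytic_at_add:
  assumes "real_analytic_at p b" "real_analytic_at q b"
  shows "real_analytic_at (\<lambda>x. p x + q x) b"
proof -
  obtain c r where c: "r > 0" "\<forall>x \<in> ball b r.
           ((\<lambda>\<alpha>. c \<alpha> * (\<Prod>i\<in>UNIV. (x $ i - b $ i) ^ \<alpha> i)) has_sum p x) UNIV"
    using assms(1) unfolding real_analytic_at_def by blast
  obtain d s where d: "s > 0" "\<forall>x \<in> ball b s.
           ((\<lambda>\<alpha>. d \<alpha> * (\<Prod>i\<in>UNIV. (x $ i - b $ i) ^ \<alpha> i)) has_sum q x) UNIV"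
    using assms(2) unfolding real_analytic_at_def by blast
  show ?thesis unfolding real_analytic_at_def
  proof (intro exI[of _ "\<lambda>\<alpha>. c \<alpha> + d \<alpha>"] exI[of _ "min r s"] conjI ballI)
    fix x assume "x \<in> ball b (min r s)"
    then show "((\<lambda>\<alpha>. (c \<alpha> + d \<alpha>) * (\<Prod>i\<in>UNIV. (x $ i - b $ i) ^ \<alpha> i)) has_sum p x + q x) UNIV"
      unfolding distrib_right using c d by (intro has_sum_add) auto
  qed (use c d in auto)
qed

lemma real_analytic_at_monomial:
  "real_analytic_at (\<lambda>x. k * (\<Prod>i\<in>UNIV. (x $ i - b $ i) ^ \<beta> i)) b"
  unfolding real_analytic_at_def
  by (intro exI[of _ "\<lambda>\<alpha>. if \<alpha> = \<beta> then k else 0"] exI[of _ 1] conjI ballI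
       has_sum_finite_neutralI[where B = "{\<beta>}"]) auto

lemma real_analytic_at_sum:
  assumes "finite A" "\<And>j. j \<in> A \<Longrightarrow> real_analytic_at (p j) b"
  shows "real_analytic_at (\<lambda>x. \<Sum>j\<in>A. p j x) b"
  using assms
proof (induction rule: finite_induct)
  case empty
  show ?case using real_analytic_at_monomial[of 0] by simp
next
  case (insert j A)
  then show ?case by (simp add: real_analytic_at_add)
qed

lemma real_analytic_at_fpoly: "real_analytic_at fpoly b" for b :: "real ^ 'n"
proof -
  let ?e = "\<lambda>i k :: 'n. if k = i then 1 else 0 :: nat"
  have e: "(\<Prod>k\<in>UNIV. h k ^ ?e i k) = h i" for h :: "'n \<Rightarrow> real" and i
    by (simp add: if_distrib[of "(^) _"] prod.delta cong: if_cong)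
  have ee: "(\<Prod>k\<in>UNIV. h k ^ (?e i k + ?e j k)) = h i * h j" for h :: "'n \<Rightarrow> real" and i j
    unfolding power_add prod.distrib e ..
  have const: "real_analytic_at (\<lambda>x. c) b" for c
    using real_analytic_at_monomial[of c b "\<lambda>_. 0"] by simp
  have lin: "real_analytic_at (\<lambda>x. c * (x $ i - b $ i)) b" for c i
    using real_analytic_at_monomial[of c b "?e i"] by (simp only: e)
  have quad: "real_analytic_at (\<lambda>x. c * ((x $ i - b $ i) * (x $ j - b $ j))) b" for c i j
    using real_analytic_at_monomial[of c b "\<lambda>k. ?e i k + ?e j k"] by (simp only: ee)
  have mult: "real_analytic_at (\<lambda>x. c * (x $ i * x $ j)) b" for c i j
  proof -
    have "(\<lambda>x. c * (x $ i * x $ j)) = (\<lambda>x. c * b $ i * b $ j + c * b $ j * (x $ i - b $ i)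
        + c * b $ i * (x $ j - b $ j) + c * ((x $ i - b $ i) * (x $ j - b $ j)))"
      by (auto simp: algebra_simps)
    moreover have "real_analytic_at \<dots> b"
      by (intro real_analytic_at_add const lin quad)
    ultimately show ?thesis by simp
  qed
  have "(fpoly :: real ^ 'n \<Rightarrow> real) = (\<lambda>x. (\<Sum>i\<in>UNIV. \<Sum>j\<in>UNIV. 1 * (x $ i * x $ j)) + (\<Sum>i\<in>UNIV. (-1) * (x $ i * x $ i)))"
    by (auto simp: fpoly_def power2_eq_square sum_product sum_negf)
  moreover have "real_analytic_at \<dots> b"
    by (intro real_analytic_at_add real_analytic_at_sum mult) auto
  ultimately show ?thesis by simp
qed

text \<open>
  The form takes a positive value on \<open>1\<close>, so its second difference in that direction is positive
  everywhere, and it cannot vanish at three equally spaced points of a line in that direction.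
\<close>

lemma fpoly_frequently_nonzero:
  fixes a :: "real ^ 'n"
  assumes "CARD('n) \<ge> 2" 
  shows "\<exists>\<^sub>F w in nhds a. fpoly w \<noteq> 0"
  unfolding frequently_def
proof
  assume "\<forall>\<^sub>F w in nhds a. \<not> fpoly w \<noteq> 0"
  then obtain e where e: "e > 0" "\<And>w. dist w a < e \<Longrightarrow> fpoly w = 0"
    by (auto simp: eventually_nhds_metric)
  define n where "n = real CARD('n)"
  have n: "n \<ge> 2" using assms by (simp add: n_def)
  define t where "t = e / (2 * norm (1 :: real ^ 'n))"
  have one: "norm (1 :: real ^ 'n) > 0" by simp
  have t: "t > 0" using e one by (simp add: t_def)
  have "norm (t *\<^sub>R (1 :: real ^ 'n)) < e" using e one by (simp add: t_def)
  then have "fpoly (a + t *\<^sub>R 1) = 0" "fpoly (a - t *\<^sub>R 1) = 0" "fpoly a = 0"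
    using e by (auto simp: dist_norm)
  moreover have "fpoly (a + t *\<^sub>R 1) + fpoly (a - t *\<^sub>R 1) = 2 * fpoly a + 2 * t\<^sup>2 * (n * (n - 1))"
    by (simp add: fpoly_def sum.distrib sum_subtractf power2_eq_square algebra_simps
        flip: n_def sum_distrib_left sum_distrib_right)
  ultimately show False using t n by auto
qed

section \<open>Slicing along a coordinate\<close>

interpretation lebesgue_factors: product_sigma_finite "\<lambda>_. lborel :: real measure"
  by standard

lemma measurable_vec_lambda [measurable]:
  "vec_lambda \<in> PiM (UNIV :: 'n set) (\<lambda>_. lborel) \<rightarrow>\<^sub>M (borel :: (real ^ 'n::finite) measure)"
  by (subst borel_measurable_euclidean_space)
     (auto simp: Basis_vec_def inner_axis)

text \<open>
  Factors indexed by coordinates, rather than by the standard basis as in the definition of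
  Lebesgue measure, allow a single coordinate to be split off.
\<close>

lemma lborel_eq_distr_PiM:
  "(lborel :: (real ^ 'n::finite) measure) = distr (PiM UNIV (\<lambda>_. lborel)) borel vec_lambda"
proof (rule lborel_eqI)
  fix l u :: "real ^ 'n"
  assume "\<And>b. b \<in> Basis \<Longrightarrow> l \<bullet> b \<le> u \<bullet> b"
  then have lu: "l $ j \<le> u $ j" for j
    by (force simp: Basis_vec_def inner_axis)
  have "vec_lambda -` box l u \<inter> space (PiM UNIV (\<lambda>_. lborel)) = PiE UNIV (\<lambda>j. {l $ j<..<u $ j})"
    by (auto simp: mem_box Basis_vec_def inner_axis space_PiM PiE_iff)
  then have "emeasure (distr (PiM UNIV (\<lambda>_. lborel)) borel vec_lambda) (box l u)
      = emeasure (PiM UNIV (\<lambda>_. lborel)) (PiE UNIV (\<lambda>j. {l $ j<..<u $ j}))"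
    by (simp add: emeasure_distr)
  also have "\<dots> = (\<Prod>j\<in>UNIV. ennreal (u $ j - l $ j))"
    using lu by (subst lebesgue_factors.emeasure_PiM) auto
  also have "\<dots> = ennreal (\<Prod>j\<in>UNIV. u $ j - l $ j)"
    using lu by (intro prod_ennreal) auto
  also have "(\<Prod>j\<in>UNIV. u $ j - l $ j) = (\<Prod>b\<in>(Basis :: (real ^ 'n) set). (u - l) \<bullet> b)"
  proof -
    have B: "(Basis :: (real ^ 'n) set) = (\<lambda>j. axis j 1) ` UNIV"
      by (auto simp: Basis_vec_def)
    show ?thesis unfolding B
      by (subst prod.reindex) (auto simp: inj_on_def axis_eq_axis inner_axis)
  qed
  finally show "emeasure (distr (PiM UNIV (\<lambda>_. lborel)) borel vec_lambda) (box l u)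
    = ennreal (\<Prod>b\<in>Basis. (u - l) \<bullet> b)" .
qed simp

lemma slice_in_borel:
  fixes A :: "(real ^ 'n) set"
  assumes "A \<in> sets borel"
  shows "{t. vec_lambda (y(i := t)) \<in> A} \<in> sets borel"
proof -
  have "continuous_on UNIV (\<lambda>t. (y(i := t)) j)" for j
    by (cases "j = i") (auto intro!: continuous_intros)
  then have "continuous_on UNIV (\<lambda>t. vec_lambda (y(i := t)) :: real ^ 'n)"
    by (rule continuous_on_vec_lambda)
  from measurable_sets[OF borel_measurable_continuous_onI[OF this] assms] show ?thesis
    by (simp add: vimage_def)
qed

text \<open>
  Cavalieri's principle for the lines parallel to the axis \<open>i\<close>.
\<close>

lemma emeasure_lborel_slices:
  fixes A :: "(real ^ 'n) set" and i :: 'n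
  assumes [measurable]: "A \<in> sets borel"
  shows "emeasure lborel A = (\<integral>\<^sup>+y. emeasure lborel {t. vec_lambda (y(i := t)) \<in> A}
           \<partial>PiM (UNIV - {i}) (\<lambda>_. lborel))"
proof -
  have ins: "insert i (UNIV - {i}) = UNIV" by auto
  have "emeasure lborel A = (\<integral>\<^sup>+x. indicator A x \<partial>lborel)" by simp
  also have "\<dots> = (\<integral>\<^sup>+y. indicator A (vec_lambda y) \<partial>PiM UNIV (\<lambda>_. lborel))"
    by (subst lborel_eq_distr_PiM, subst nn_integral_distr) auto
  also have "\<dots> = (\<integral>\<^sup>+y. \<integral>\<^sup>+t. indicator A (vec_lambda (y(i := t))) \<partial>lborel \<partial>PiM (UNIV - {i}) (\<lambda>_. lborel))"
    using lebesgue_factors.product_nn_integral_insert[of "UNIV - {i}" i "\<lambda>y. indicator A (vec_lambda y)"]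
    by (simp add: ins)
  also have "\<dots> = (\<integral>\<^sup>+y. emeasure lborel {t. vec_lambda (y(i := t)) \<in> A} \<partial>PiM (UNIV - {i}) (\<lambda>_. lborel))"
  proof (rule nn_integral_cong)
    fix y :: "'n \<Rightarrow> real"
    have "(\<integral>\<^sup>+t. indicator A (vec_lambda (y(i := t))) \<partial>lborel)
        = (\<integral>\<^sup>+t. indicator {t. vec_lambda (y(i := t)) \<in> A} t \<partial>lborel)"
      by (intro nn_integral_cong) (auto simp: indicator_def)
    then show "(\<integral>\<^sup>+t. indicator A (vec_lambda (y(i := t))) \<partial>lborel) = emeasure lborel {t. vec_lambda (y(i := t)) \<in> A}"
      using slice_in_borel[OF assms] by simp
  qed
  finally show ?thesis .
qed

text \<open>
  The shear turns lines parallel to the axis \<open>i\<close> into lines whose direction also has the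
  component \<open>c\<close> along each axis in \<open>J\<close>.
\<close>

definition shear :: "'n \<Rightarrow> 'n set \<Rightarrow> real \<Rightarrow> real ^ 'n \<Rightarrow> real ^ 'n" where
  "shear i J c x = (\<chi> j. x $ j + (if j \<in> J then c * x $ i else 0))"

lemma continuous_on_shear: "continuous_on S (shear i J c)"
  unfolding shear_def
proof (intro continuous_on_vec_lambda continuous_on_add)
  show "continuous_on S (\<lambda>x. if j \<in> J then c * x $ i else 0)" for j
    by (cases "j \<in> J") (auto intro!: continuous_intros)
qed (intro continuous_intros)

lemma shear_inverse: "i \<notin> J \<Longrightarrow> shear i J c (shear i J (- c) x) = x"
  by (auto simp: shear_def vec_eq_iff)

text \<open>
  Shearing into one coordinate \<open>k\<close> translates every slice parallel to the axis \<open>k\<close>, hence keeps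
  its length; the general shear is a composition of such ones.
\<close>

lemma emeasure_shear_vimage:
  fixes A :: "(real ^ 'n) set" and i :: 'n
  assumes "i \<notin> J" and A: "A \<in> sets borel"
  shows "emeasure lborel (shear i J c -` A) = emeasure lborel A"
  using finite[of J] assms
proof (induction J arbitrary: A rule: finite_induct)
  case empty
  then show ?case by (simp add: shear_def)
next
  case (insert k J)
  have [measurable]: "shear i J c \<in> borel_measurable borel" for J
    by (intro borel_measurable_continuous_onI continuous_on_shear)
  have "i \<noteq> k" using insert.prems by auto
  have B: "shear i J c -` A \<in> sets borel" 
    using insert.prems measurable_sets[of "shear i J c" borel borel A] by simp
  have B': "shear i {k} c -` shear i J c -` A \<in> sets borel" 
    using B measurable_sets[of "shear i {k} c" borel borel "shear i J c -` A"] by simp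
  have eq: "shear i (insert k J) c -` A = shear i {k} c -` shear i J c -` A"
    using insert by (auto simp: shear_def cong: if_cong) (auto elim!: back_subst[of "\<lambda>x. x \<in> A"] simp: vec_eq_iff)
  have "emeasure lborel {t. vec_lambda (y(k := t)) \<in> shear i {k} c -` shear i J c -` A}
      = emeasure lborel {t. vec_lambda (y(k := t)) \<in> shear i J c -` A}" for y
  proof -
    have "shear i {k} c (vec_lambda (y(k := t))) = vec_lambda (y(k := t + c * y i))" for t
      using \<open>i \<noteq> k\<close> by (auto simp: shear_def vec_eq_iff)
    then have *: "{t. vec_lambda (y(k := t)) \<in> shear i {k} c -` shear i J c -` A}
        = (+) (c * y i) -` {t. vec_lambda (y(k := t)) \<in> shear i J c -` A}"
      by (auto simp: add.commute)
    show ?thesis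
      unfolding * using emeasure_distr[of "(+) (c * y i)" lborel borel "{t. vec_lambda (y(k := t)) \<in> shear i J c -` A}"]
        slice_in_borel[OF B] by (simp add: lborel_distr_plus)
  qed
  then have "emeasure lborel (shear i {k} c -` shear i J c -` A) = emeasure lborel (shear i J c -` A)"
    unfolding emeasure_lborel_slices[OF B, of k] emeasure_lborel_slices[OF B', of k] by simp
  then show ?case using insert by (simp add: eq)
qed

section \<open>Linear growth of the volume by dominated convergence\<close>

lemma emeasure_PiM_cube:
  assumes "finite I" "\<eta> \<ge> 0"
  shows "emeasure (PiM I (\<lambda>_. lborel)) (PiE I (\<lambda>j. {b j - \<eta><..<b j + \<eta>})) = ennreal ((2 * \<eta>) ^ card I)"
proof -
  have "emeasure (PiM I (\<lambda>_. lborel)) (PiE I (\<lambda>j. {b j - \<eta><..<b j + \<eta>})) = (\<Prod>j\<in>I. ennreal (2 * \<eta>))"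
    using assms by (subst lebesgue_factors.emeasure_PiM) auto
  then show ?thesis using assms by (simp add: ennreal_power)
qed

lemma open_box_sublevel:
  fixes p :: "real ^ 'n \<Rightarrow> real"
  assumes "continuous_on UNIV p"
  shows "open {x. (\<forall>j. j \<noteq> i \<longrightarrow> \<bar>x $ j - a $ j\<bar> < \<eta>) \<and> \<bar>p x\<bar> < \<delta>}"
proof -
  have "open {x. j \<noteq> i \<longrightarrow> \<bar>x $ j - a $ j\<bar> < \<eta>}" for j
    by (cases "j = i") (auto intro!: open_Collect_less continuous_intros)
  then have "open (\<Inter>j. {x. j \<noteq> i \<longrightarrow> \<bar>x $ j - a $ j\<bar> < \<eta>})"
    by (intro open_INT) auto
  moreover have "open {x. \<bar>p x\<bar> < \<delta>}"
    by (intro open_Collect_less continuous_intros assms)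
  ultimately have "open ((\<Inter>j. {x. j \<noteq> i \<longrightarrow> \<bar>x $ j - a $ j\<bar> < \<eta>}) \<inter> {x. \<bar>p x\<bar> < \<delta>})"
    by (rule open_Int)
  then show ?thesis
    by (rule back_subst[where P = "open"]) auto
qed

lemma norm_less_if_components_less:
  fixes x :: "real ^ 'n"
  assumes "\<And>j. \<bar>x $ j\<bar> < r"
  shows "norm x < real CARD('n) * r"
proof -
  have "norm x \<le> (\<Sum>j\<in>UNIV. \<bar>x $ j\<bar>)" by (rule norm_le_l1_cart)
  also have "\<dots> < (\<Sum>j\<in>(UNIV :: 'n set). r)" by (intro sum_strict_mono assms) auto
  finally show ?thesis by simp
qed

text \<open>
  If the slices in direction \<open>i\<close> of the sublevel sets have length \<open>len \<epsilon> y\<close> with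
  \<open>len \<epsilon> y / \<epsilon>\<close> converging to \<open>h y\<close> under an integrable bound \<open>k\<close>, then by dominated
  convergence the volume is asymptotic to \<open>C * \<epsilon>\<close>, where \<open>C\<close> is the integral of \<open>h\<close>.
  The lower bound on \<open>h\<close> makes \<open>C\<close> positive.  The neighbourhood restricts the coordinate \<open>i\<close>
  only through \<open>\<bar>p x\<bar> < \<delta>\<close>, so that for \<open>\<epsilon> < \<delta>\<close> its boundary never cuts a slice.
\<close>

lemma volume_pair_1_1_if_slices:
  fixes p :: "real ^ 'n \<Rightarrow> real" and a :: "real ^ 'n" and i :: 'n and \<eta> \<delta> c :: real
    and h k :: "('n \<Rightarrow> real) \<Rightarrow> real"
  defines "P \<equiv> PiM (UNIV - {i}) (\<lambda>_. lborel :: real measure)"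
    and "Q \<equiv> PiE (UNIV - {i}) (\<lambda>j. {a $ j - \<eta><..<a $ j + \<eta>})"
  assumes p: "continuous_on UNIV p" and pos: "\<eta> > 0" "\<delta> > 0" "c > 0"
    and slices: "\<And>y \<epsilon>. y \<in> Q \<Longrightarrow> 0 < \<epsilon> \<Longrightarrow> \<epsilon> < \<delta> \<Longrightarrow>
      emeasure lborel {t. \<bar>p (vec_lambda (y(i := t)))\<bar> \<le> \<epsilon>} = ennreal (len \<epsilon> y)"
    and meas [measurable]: "\<And>\<epsilon>. len \<epsilon> \<in> borel_measurable P" "h \<in> borel_measurable P"
    and nonneg: "\<And>y \<epsilon>. y \<in> Q \<Longrightarrow> 0 < \<epsilon> \<Longrightarrow> len \<epsilon> y \<ge> 0"
    and dominated: "AE y in P. y \<in> Q \<longrightarrow> (\<forall>\<epsilon>\<in>{0<..<\<delta>}. len \<epsilon> y \<le> \<epsilon> * k y)"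
    and integrable: "integrable P (\<lambda>y. indicator Q y * k y)"
    and limit: "AE y in P. y \<in> Q \<longrightarrow> ((\<lambda>\<epsilon>. len \<epsilon> y / \<epsilon>) \<longlongrightarrow> h y) (at_right 0) \<and> c \<le> h y"
  shows "volume_pair p {x. (\<forall>j. j \<noteq> i \<longrightarrow> \<bar>x $ j - a $ j\<bar> < \<eta>) \<and> \<bar>p x\<bar> < \<delta>} (1, 1)"
proof -
  define V where "V = {x. (\<forall>j. j \<noteq> i \<longrightarrow> \<bar>x $ j - a $ j\<bar> < \<eta>) \<and> \<bar>p x\<bar> < \<delta>}"
  define H where "H = (\<integral>y. indicator Q y * h y \<partial>P)"
  have [measurable]: "Q \<in> sets P"
    unfolding Q_def P_def by (intro sets_PiM_I_finite) auto
  have [measurable]: "p \<in> borel_measurable borel"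
    by (intro borel_measurable_continuous_onI p)
  let ?s = "\<lambda>t y. indicator Q y * (len (inverse t) y / inverse t)"
  have dct: "integrable P (\<lambda>y. indicator Q y * h y)"
    "((\<lambda>t. integral\<^sup>L P (?s t)) \<longlongrightarrow> H) at_top"
  proof -
    have 1: "\<forall>\<^sub>F t in at_top. AE y in P. norm (?s t y) \<le> indicator Q y * k y"
      using eventually_gt_at_top[of "1 / \<delta>"]
    proof eventually_elim
      case (elim t)
      have "t > 0" using elim pos by (meson divide_pos_pos less_trans zero_less_one)
      moreover from this have "inverse t < \<delta>"
        using elim pos by (simp add: field_simps)
      ultimately have t: "inverse t \<in> {0<..<\<delta>}" by simp
      show ?case using dominated
      proof eventually_elim
        case (elim y)
        show ?case
        proof (cases "y \<in> Q")
          case True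
          with elim t have "len (inverse t) y \<le> inverse t * k y" by blast
          with t nonneg[of y "inverse t"] True show ?thesis by (simp add: field_simps)
        qed simp
      qed
    qed
    have 2: "AE y in P. ((\<lambda>t. ?s t y) \<longlongrightarrow> indicator Q y * h y) at_top"
      using limit
    proof eventually_elim
      case (elim y)
      then show ?case
        by (cases "y \<in> Q") (auto simp: filterlim_at_right_to_top)
    qed
    show "integrable P (\<lambda>y. indicator Q y * h y)"
      using integrable_dominated_convergence_at_top[OF _ _ integrable 2 1] by simp
    show "((\<lambda>t. integral\<^sup>L P (?s t)) \<longlongrightarrow> H) at_top"
      unfolding H_def using integral_dominated_convergence_at_top[OF _ _ integrable 2 1] by simp
  qed
  have volume: "sublevel_volume p V \<epsilon> / \<epsilon> = (\<integral>y. indicator Q y * (len \<epsilon> y / \<epsilon>) \<partial>P)"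
    if \<epsilon>: "0 < \<epsilon>" "\<epsilon> < \<delta>" for \<epsilon>
  proof -
    let ?A = "{w \<in> V. \<bar>p w\<bar> \<le> \<epsilon>}"
    have A [measurable]: "?A \<in> sets borel"
      unfolding V_def by measurable
    have "emeasure lborel ?A = (\<integral>\<^sup>+y. ennreal (indicator Q y * len \<epsilon> y) \<partial>P)"
      unfolding emeasure_lborel_slices[OF A, of i] P_def[symmetric]
    proof (rule nn_integral_cong)
      fix y assume y: "y \<in> space P"
      have Q: "y \<in> Q \<longleftrightarrow> (\<forall>j. j \<noteq> i \<longrightarrow> \<bar>y j - a $ j\<bar> < \<eta>)"
      proof -
        have "a $ j - \<eta> < y j \<and> y j < a $ j + \<eta> \<longleftrightarrow> \<bar>y j - a $ j\<bar> < \<eta>" for j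
          by auto
        then show ?thesis
          using y by (auto simp: Q_def P_def space_PiM PiE_iff)
      qed
      have "{t. vec_lambda (y(i := t)) \<in> ?A}
          = (if y \<in> Q then {t. \<bar>p (vec_lambda (y(i := t)))\<bar> \<le> \<epsilon>} else {})"
        using \<epsilon> by (auto simp: V_def Q)
      then show "emeasure lborel {t. vec_lambda (y(i := t)) \<in> ?A} = ennreal (indicator Q y * len \<epsilon> y)"
        using slices[of y \<epsilon>] \<epsilon> by simp
    qed
    then have "measure lborel ?A = (\<integral>y. indicator Q y * len \<epsilon> y \<partial>P)"
      unfolding measure_def using nonneg \<epsilon> by (subst integral_eq_nn_integral) (auto simp: indicator_def)
    moreover have "measure lebesgue ?A = measure lborel ?A"
      using A by (intro measure_completion) simp
    moreover have "(\<integral>y. indicator Q y * (len \<epsilon> y / \<epsilon>) \<partial>P) = (\<integral>y. indicator Q y * len \<epsilon> y / \<epsilon> \<partial>P)"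
      by simp
    ultimately show ?thesis unfolding sublevel_volume_def by simp
  qed
  have "\<forall>\<^sub>F \<epsilon> in at_right 0. (\<integral>y. indicator Q y * (len \<epsilon> y / \<epsilon>) \<partial>P) = sublevel_volume p V \<epsilon> / \<epsilon>"
    using eventually_at_right_less[of "0 :: real"] eventually_at_right_real[OF pos(2)]
    by eventually_elim (simp add: volume)
  moreover have "((\<lambda>\<epsilon>. \<integral>y. indicator Q y * (len \<epsilon> y / \<epsilon>) \<partial>P) \<longlongrightarrow> H) (at_right 0)"
    using dct(2) by (simp add: filterlim_at_right_to_top)
  ultimately have lim: "((\<lambda>\<epsilon>. sublevel_volume p V \<epsilon> / \<epsilon>) \<longlongrightarrow> H) (at_right 0)"
    by (rule Lim_transform_eventually[rotated])
  have Q: "emeasure P Q = ennreal ((2 * \<eta>) ^ card (UNIV - {i}))"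
    unfolding P_def Q_def using pos by (intro emeasure_PiM_cube) auto
  have "0 < c * measure P Q"
    using pos by (simp add: measure_def Q)
  also have "\<dots> = (\<integral>y. c * indicator Q y \<partial>P)"
    by simp
  also have "\<dots> \<le> H"
    unfolding H_def
  proof (rule integral_mono_AE[OF _ dct(1)])
    show "integrable P (\<lambda>y. c * indicator Q y)"
      by (simp add: Q)
    show "AE y in P. c * indicator Q y \<le> indicator Q y * h y"
      using limit by eventually_elim (auto simp: indicator_def)
  qed
  finally have "H > 0" .
  have "((\<lambda>\<epsilon>. sublevel_volume p V \<epsilon> / \<epsilon> / H) \<longlongrightarrow> H / H) (at_right 0)"
    using \<open>H > 0\<close> by (intro tendsto_intros lim) auto
  then have ratio: "((\<lambda>\<epsilon>. sublevel_volume p V \<epsilon> / \<epsilon> / H) \<longlongrightarrow> 1) (at_right 0)"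
    using \<open>H > 0\<close> by simp
  have "\<forall>\<^sub>F \<epsilon> in at_right 0. sublevel_volume p V \<epsilon> / \<epsilon> / H
      = sublevel_volume p V \<epsilon> / (H * \<epsilon> powr 1 * (- ln \<epsilon>) ^ (1 - 1))"
    using eventually_at_right_less[of "0 :: real"] by eventually_elim (simp add: field_simps)
  from Lim_transform_eventually[OF ratio this]
  have "((\<lambda>\<epsilon>. sublevel_volume p V \<epsilon> / (H * \<epsilon> powr 1 * (- ln \<epsilon>) ^ (1 - 1))) \<longlongrightarrow> 1) (at_right 0)" .
  then have "sublevel_volume p V \<sim>[at_right 0] (\<lambda>\<epsilon>. H * \<epsilon> powr 1 * (- ln \<epsilon>) ^ (1 - 1))"
    by (rule asymp_equivI')
  then show ?thesis
    using \<open>H > 0\<close> by (auto simp: volume_pair_def V_def[symmetric] Suc_le_eq)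
qed

section \<open>Slices of affine and quadratic functions\<close>

lemma emeasure_slice_affine:
  fixes L g \<epsilon> :: real
  assumes "L \<noteq> 0" "\<epsilon> \<ge> 0"
  shows "emeasure lborel {t. \<bar>L * t + g\<bar> \<le> \<epsilon>} = ennreal (2 * \<epsilon> / \<bar>L\<bar>)"
proof -
  have "\<bar>L * t + g\<bar> \<le> \<epsilon> \<longleftrightarrow> \<bar>t + g / L\<bar> \<le> \<epsilon> / \<bar>L\<bar>" for t
  proof -
    have "L * t + g = (t + g / L) * L" using assms by (simp add: distrib_right mult.commute[of L])
    then have "\<bar>L * t + g\<bar> = \<bar>t + g / L\<bar> * \<bar>L\<bar>" by (simp only: abs_mult)
    then show ?thesis using pos_le_divide_eq[of "\<bar>L\<bar>" "\<bar>t + g / L\<bar>" \<epsilon>] assms(1) by simp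
  qed
  moreover have "{t. \<bar>t + u\<bar> \<le> v} = {- u - v .. - u + v}" for u v :: real
    by auto
  ultimately have "{t. \<bar>L * t + g\<bar> \<le> \<epsilon>} = {- (g / L) - \<epsilon> / \<bar>L\<bar> .. - (g / L) + \<epsilon> / \<bar>L\<bar>}"
    by (simp only:)
  also have "emeasure lborel \<dots> = ennreal (2 * \<epsilon> / \<bar>L\<bar>)"
    using assms by simp
  finally show ?thesis .
qed

lemma emeasure_slice_quadratic:
  fixes c b q \<epsilon> :: real
  assumes "c > 0" "\<epsilon> > 0" "q \<ge> 0"
  shows "emeasure lborel {t. \<bar>c * (t + b)\<^sup>2 - q\<bar> \<le> \<epsilon>}
    = ennreal (2 * (sqrt ((q + \<epsilon>) / c) - sqrt (max 0 ((q - \<epsilon>) / c))))"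
proof -
  define A where "A = sqrt (max 0 ((q - \<epsilon>) / c))"
  define B where "B = sqrt ((q + \<epsilon>) / c)"
  have AB: "0 \<le> A" "A \<le> B"
    unfolding A_def B_def using assms by (auto simp: divide_right_mono)
  have *: "\<bar>c * (t + b)\<^sup>2 - q\<bar> \<le> \<epsilon> \<longleftrightarrow> A \<le> \<bar>t + b\<bar> \<and> \<bar>t + b\<bar> \<le> B" for t
  proof -
    have "A \<le> \<bar>t + b\<bar> \<longleftrightarrow> (q - \<epsilon>) / c \<le> (t + b)\<^sup>2"
      unfolding A_def by (simp flip: real_sqrt_abs)
    moreover have "\<bar>t + b\<bar> \<le> B \<longleftrightarrow> (t + b)\<^sup>2 \<le> (q + \<epsilon>) / c"
      unfolding B_def by (simp flip: real_sqrt_abs)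
    ultimately show ?thesis
      using assms by (auto simp: field_simps abs_le_iff)
  qed
  have "{t. \<bar>c * (t + b)\<^sup>2 - q\<bar> \<le> \<epsilon>} = {- b - B .. - b + B} - {- b - A <..< - b + A}"
    unfolding * using AB by (auto simp: abs_if split: if_splits)
  moreover have "emeasure lborel ({- b - B .. - b + B} - {- b - A <..< - b + A})
    = emeasure lborel {- b - B .. - b + B} - emeasure lborel {- b - A <..< - b + A}"
    using AB by (intro emeasure_Diff) auto
  ultimately show ?thesis
    using AB by (simp add: A_def[symmetric] B_def[symmetric] ennreal_minus)
qed

lemma integrable_abs_powr:
  fixes s \<eta> :: real
  assumes "s > -1" "\<eta> > 0"
  shows "integrable lborel (\<lambda>t. indicator {- \<eta><..<\<eta>} t * \<bar>t\<bar> powr s)"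
proof -
  have "(\<lambda>t. t powr s) absolutely_integrable_on {0..\<eta>}"
    using assms by (intro nonnegative_absolutely_integrable_1 integrable_on_powr_from_0) auto
  then have "set_integrable lborel {0..\<eta>} (\<lambda>t. t powr s)"
    unfolding set_integrable_def by (subst (asm) integrable_completion) auto
  then have 1: "integrable lborel (\<lambda>t. indicator {0..\<eta>} t * t powr s)"
    by (simp add: set_integrable_def)
  have 2: "integrable lborel (\<lambda>t. indicator {0..\<eta>} (- t) * (- t) powr s)"
    using lborel_integrable_real_affine[OF 1, of "-1" 0] by simp
  show ?thesis
    by (rule Bochner_Integration.integrable_bound[OF Bochner_Integration.integrable_add[OF 1 2]])
       (auto simp: indicator_def)
qed

section \<open>Zeros other than the origin\<close>

lemma continuous_on_fpoly: "continuous_on S fpoly"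
  unfolding fpoly_def by (intro continuous_intros)

text \<open>
  The form contains no squares, so its slope in direction \<open>i\<close> is free of the coordinate \<open>i\<close>.
\<close>

lemma fpoly_slice:
  fixes y :: "'n::finite \<Rightarrow> real"
  shows "fpoly (vec_lambda (y(i := t))) = 2 * (\<Sum>j\<in>UNIV - {i}. y j) * t
    + ((\<Sum>j\<in>UNIV - {i}. y j)\<^sup>2 - (\<Sum>j\<in>UNIV - {i}. (y j)\<^sup>2))"
proof -
  have "(\<Sum>j\<in>UNIV. vec_lambda (y(i := t)) $ j) = t + (\<Sum>j\<in>UNIV - {i}. y j)"
    "(\<Sum>j\<in>UNIV. (vec_lambda (y(i := t)) $ j)\<^sup>2) = t\<^sup>2 + (\<Sum>j\<in>UNIV - {i}. (y j)\<^sup>2)"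
    by (simp_all add: sum.remove[of UNIV i])
  then show ?thesis by (simp only: fpoly_def) (simp add: power2_sum algebra_simps)
qed

text \<open>
  All \<open>n\<close> slopes vanish only if every coordinate equals the sum \<open>s\<close> of the coordinates, and then
  \<open>s = n * s\<close>.
\<close>

lemma fpoly_has_nonzero_slope:
  fixes a :: "real ^ 'n"
  assumes "CARD('n) \<ge> 2" "a \<noteq> 0"
  shows "\<exists>i. (\<Sum>j\<in>UNIV - {i}. a $ j) \<noteq> 0"
proof (rule ccontr)
  assume "\<not> ?thesis"
  then have *: "a $ i = (\<Sum>j\<in>UNIV. a $ j)" for i
    by (simp add: sum.remove[of UNIV i])
  have "(\<Sum>j\<in>UNIV. a $ j) = real CARD('n) * (\<Sum>j\<in>UNIV. a $ j)"
    by (subst (1) sum.cong[OF refl *]) simp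
  then have "(\<Sum>j\<in>UNIV. a $ j) = 0" using assms by auto
  with * have "a = 0" by (simp add: vec_eq_iff)
  with assms show False by simp
qed

text \<open>
  Off the origin the form grows linearly: if its slope in direction \<open>i\<close> does not vanish at \<open>a\<close>,
  the slices of the sublevel sets near \<open>a\<close> have length exactly \<open>2 * \<epsilon>\<close> divided by the absolute
  value of the slope, which is bounded away from zero.
\<close>

lemma small_volume_pair_fpoly_nonzero:
  fixes a :: "real ^ 'n"
  assumes n: "CARD('n) \<ge> 2" and a: "a \<noteq> 0" "fpoly a = 0" and "e > 0"
  shows "\<exists>V. open V \<and> a \<in> V \<and> V \<subseteq> ball a e \<and> volume_pair fpoly V (1, 1)"
proof -
  obtain i where i: "(\<Sum>j\<in>UNIV - {i}. a $ j) \<noteq> 0"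
    using fpoly_has_nonzero_slope[OF n a(1)] by blast
  define L where "L y = 2 * (\<Sum>j\<in>UNIV - {i}. y j)" for y :: "'n \<Rightarrow> real"
  define m where "m = \<bar>L (($) a)\<bar>"
  have m: "m > 0" using i by (simp add: m_def L_def)
  define r where "r = e / real CARD('n)"
  have r: "r > 0" using assms by (simp add: r_def)
  \<comment> \<open>On the neighbourhood the slope is at least \<open>m / 2\<close>, so values that differ by less than
    \<open>2 * \<delta>\<close> on a line are taken at points at distance less than \<open>r\<close>.\<close>
  define \<delta> where "\<delta> = r * m / 4"
  have \<delta>: "\<delta> > 0" using r m by (simp add: \<delta>_def)
  have "isCont (\<lambda>x. L (($) x)) a" unfolding L_def by (intro continuous_intros)
  then obtain d1 where d1: "d1 > 0" "\<And>x. dist x a < d1 \<Longrightarrow> \<bar>L (($) x) - L (($) a)\<bar> < m / 2"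
    using m unfolding continuous_at_eps_delta by (metis dist_real_def half_gt_zero)
  have "isCont fpoly a" using continuous_on_fpoly[of "UNIV :: (real ^ 'n) set"] by (simp add: continuous_on_eq_continuous_at)
  then obtain d2 where d2: "d2 > 0" "\<And>x. dist x a < d2 \<Longrightarrow> \<bar>fpoly x\<bar> < \<delta>"
    using \<delta> a(2) unfolding continuous_at_eps_delta by (metis dist_real_def diff_zero)
  define \<eta> where "\<eta> = min r (min d1 d2 / real CARD('n))"
  have \<eta>: "\<eta> > 0" "\<eta> \<le> r" "real CARD('n) * \<eta> \<le> min d1 d2"
    using r d1 d2 by (auto simp: \<eta>_def min_def field_simps)
  \<comment> \<open>Points of the neighbourhood are not yet known to be close to \<open>a\<close> in the coordinate \<open>i\<close>.
    Replacing that coordinate by the one of \<open>a\<close> keeps the slope and makes continuity at \<open>a\<close>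
    applicable.\<close>
  have near: "\<bar>L y - L (($) a)\<bar> < m / 2" "\<bar>fpoly (vec_lambda (y(i := a $ i)))\<bar> < \<delta>"
    if y: "\<And>j. j \<noteq> i \<Longrightarrow> \<bar>y j - a $ j\<bar> < \<eta>" for y
  proof -
    let ?x = "vec_lambda (y(i := a $ i))"
    have "norm (?x - a) < real CARD('n) * \<eta>"
      using y \<eta> by (intro norm_less_if_components_less) auto
    then have "dist ?x a < min d1 d2" using \<eta> by (simp add: dist_norm)
    moreover have "L (($) ?x) = L y" by (simp add: L_def)
    ultimately show "\<bar>L y - L (($) a)\<bar> < m / 2" "\<bar>fpoly ?x\<bar> < \<delta>"
      using d1(2)[of ?x] d2(2)[of ?x] by auto
  qed
  have slope: "m / 2 < \<bar>L y\<bar>" "\<bar>L y\<bar> < 3 / 2 * m"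
    if y: "\<And>j. j \<noteq> i \<Longrightarrow> \<bar>y j - a $ j\<bar> < \<eta>" for y
    using near(1)[OF y] by (auto simp: m_def abs_if split: if_splits)
  define V where "V = {x. (\<forall>j. j \<noteq> i \<longrightarrow> \<bar>x $ j - a $ j\<bar> < \<eta>) \<and> \<bar>fpoly x\<bar> < \<delta>}"
  have "x \<in> ball a e" if x: "x \<in> V" for x
  proof -
    have xj: "\<bar>x $ j - a $ j\<bar> < \<eta>" if "j \<noteq> i" for j
      using x that by (simp add: V_def)
    have upd: "vec_lambda ((($) x)(i := x $ i)) = x" by (simp add: vec_eq_iff)
    have "L (($) x) * (x $ i - a $ i) = fpoly x - fpoly (vec_lambda ((($) x)(i := a $ i)))"
      using fpoly_slice[of "($) x" i "x $ i"] fpoly_slice[of "($) x" i "a $ i"]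
      unfolding upd L_def by (simp add: algebra_simps)
    also have "\<bar>\<dots>\<bar> < 2 * \<delta>"
      using x near(2)[of "($) x", OF xj] by (auto simp: V_def)
    finally have "\<bar>L (($) x)\<bar> * \<bar>x $ i - a $ i\<bar> < m / 2 * r"
      by (simp add: abs_mult \<delta>_def mult.commute)
    moreover have "m / 2 * \<bar>x $ i - a $ i\<bar> \<le> \<bar>L (($) x)\<bar> * \<bar>x $ i - a $ i\<bar>"
      using slope(1)[of "($) x", OF xj] by (intro mult_right_mono) auto
    ultimately have "m / 2 * \<bar>x $ i - a $ i\<bar> < m / 2 * r" by linarith
    then have "\<bar>x $ i - a $ i\<bar> < r"
      using m by (subst (asm) mult_less_cancel_left_pos) auto
    then have "\<bar>(x - a) $ j\<bar> < r" for j
      using xj[of j] \<eta> by (cases "j = i") auto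
    from norm_less_if_components_less[OF this] show ?thesis
      by (simp add: r_def dist_norm norm_minus_commute)
  qed
  moreover have "a \<in> V" using a \<eta> \<delta> by (simp add: V_def)
  moreover have "open V" unfolding V_def by (intro open_box_sublevel continuous_on_fpoly)
  moreover have "volume_pair fpoly V (1, 1)"
    unfolding V_def
  proof (rule volume_pair_1_1_if_slices[where len = "\<lambda>\<epsilon> y. 2 * \<epsilon> / \<bar>L y\<bar>"
        and k = "\<lambda>_. 4 / m" and h = "\<lambda>y. 2 / \<bar>L y\<bar>" and c = "4 / (3 * m)"])
    let ?P = "PiM (UNIV - {i}) (\<lambda>_. lborel :: real measure)"
    let ?Q = "PiE (UNIV - {i}) (\<lambda>j. {a $ j - \<eta><..<a $ j + \<eta>})"
    have Q: "\<bar>y j - a $ j\<bar> < \<eta>" if "y \<in> ?Q" "j \<noteq> i" for y j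
    proof -
      have "y j \<in> {a $ j - \<eta><..<a $ j + \<eta>}" using that by (auto simp: PiE_iff)
      then show ?thesis by auto
    qed
    show "emeasure lborel {t. \<bar>fpoly (vec_lambda (y(i := t)))\<bar> \<le> \<epsilon>} = ennreal (2 * \<epsilon> / \<bar>L y\<bar>)"
      if "y \<in> ?Q" "0 < \<epsilon>" "\<epsilon> < \<delta>" for y \<epsilon>
    proof -
      have "L y \<noteq> 0" using slope(1)[OF Q[OF that(1)]] m by auto
      then show ?thesis
        using emeasure_slice_affine[of "L y" \<epsilon> "(\<Sum>j\<in>UNIV - {i}. y j)\<^sup>2 - (\<Sum>j\<in>UNIV - {i}. (y j)\<^sup>2)"] that
        unfolding fpoly_slice by (simp add: L_def)
    qed
    show "(\<lambda>y. 2 * \<epsilon> / \<bar>L y\<bar>) \<in> borel_measurable ?P" for \<epsilon>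
      unfolding L_def by measurable
    show "(\<lambda>y. 2 / \<bar>L y\<bar>) \<in> borel_measurable ?P"
      unfolding L_def by measurable
    have "2 * \<epsilon> / \<bar>L y\<bar> \<le> \<epsilon> * (4 / m)" if "y \<in> ?Q" "0 < \<epsilon>" for y \<epsilon>
    proof -
      have "2 * \<epsilon> / \<bar>L y\<bar> \<le> 2 * \<epsilon> / (m / 2)"
        using slope(1)[OF Q[OF that(1)]] m that by (intro divide_left_mono mult_pos_pos) auto
      then show ?thesis by (simp add: mult.commute)
    qed
    then show "AE y in ?P. y \<in> ?Q \<longrightarrow> (\<forall>\<epsilon>\<in>{0<..<\<delta>}. 2 * \<epsilon> / \<bar>L y\<bar> \<le> \<epsilon> * (4 / m))"
      by auto
    have "?Q \<in> sets ?P" by (intro sets_PiM_I_finite) auto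
    moreover have "emeasure ?P ?Q < \<infinity>" using \<eta> by (simp add: emeasure_PiM_cube)
    ultimately show "integrable ?P (\<lambda>y. indicator ?Q y * (4 / m))"
      by (intro integrable_mult_left) auto
    have "((\<lambda>\<epsilon>. 2 * \<epsilon> / \<bar>L y\<bar> / \<epsilon>) \<longlongrightarrow> 2 / \<bar>L y\<bar>) (at_right 0)" for y
    proof -
      have "\<forall>\<^sub>F \<epsilon> in at_right 0. 2 / \<bar>L y\<bar> = 2 * \<epsilon> / \<bar>L y\<bar> / \<epsilon>"
        using eventually_at_right_less[of "0 :: real"] by eventually_elim simp
      then show ?thesis by (rule Lim_transform_eventually[OF tendsto_const])
    qed
    moreover have "4 / (3 * m) \<le> 2 / \<bar>L y\<bar>" if "y \<in> ?Q" for y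
      using slope[OF Q[OF that]] m by (simp add: field_simps)
    ultimately show "AE y in ?P. y \<in> ?Q \<longrightarrow>
        ((\<lambda>\<epsilon>. 2 * \<epsilon> / \<bar>L y\<bar> / \<epsilon>) \<longlongrightarrow> 2 / \<bar>L y\<bar>) (at_right 0) \<and> 4 / (3 * m) \<le> 2 / \<bar>L y\<bar>"
      by (intro AE_I2) simp
  qed (use \<eta> \<delta> m in \<open>auto intro: continuous_on_fpoly\<close>)
  ultimately show ?thesis by blast
qed

section \<open>The origin in dimension at least three\<close>

lemma volume_pair_shear:
  fixes p :: "real ^ 'n \<Rightarrow> real"
  assumes p: "continuous_on UNIV p" and "open V" "i \<notin> J" and V: "volume_pair (\<lambda>x. p (shear i J c x)) V lm"
  shows "volume_pair p (shear i J (- c) -` V) lm"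
proof -
  have "sublevel_volume p (shear i J (- c) -` V) \<epsilon> = sublevel_volume (\<lambda>x. p (shear i J c x)) V \<epsilon>" for \<epsilon>
  proof -
    let ?A = "{x \<in> V. \<bar>p (shear i J c x)\<bar> \<le> \<epsilon>}"
    have [measurable]: "shear i J c \<in> borel_measurable borel" for c
      by (intro borel_measurable_continuous_onI continuous_on_shear)
    have [measurable]: "p \<in> borel_measurable borel" "V \<in> sets borel"
      using assms by (auto intro: borel_measurable_continuous_onI)
    have A: "?A \<in> sets borel" by measurable
    have A': "shear i J (- c) -` ?A \<in> sets borel"
      using A measurable_sets[of "shear i J (- c)" borel borel ?A] by simp
    have "{w \<in> shear i J (- c) -` V. \<bar>p w\<bar> \<le> \<epsilon>} = shear i J (- c) -` ?A"
      using shear_inverse[OF \<open>i \<notin> J\<close>] by auto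
    then show ?thesis
      using emeasure_shear_vimage[OF \<open>i \<notin> J\<close> A, of "- c"] A A'
      by (simp add: sublevel_volume_def measure_def)
  qed
  then have "sublevel_volume p (shear i J (- c) -` V) = sublevel_volume (\<lambda>x. p (shear i J c x)) V" ..
  with V show ?thesis by (simp add: volume_pair_def)
qed

text \<open>
  Completing the square along the direction \<open>(1, \<dots>, 1)\<close>, on which the form is positive.  The
  subtracted term is positive definite in the other variables, because the form has signature
  \<open>(1, n - 1)\<close>.
\<close>

lemma fpoly_shear_slice:
  fixes y :: "'n::finite \<Rightarrow> real" and i :: 'n
  defines "n \<equiv> real CARD('n)" and "\<sigma> \<equiv> \<Sum>j\<in>UNIV - {i}. y j"
  shows "fpoly (shear i (UNIV - {i}) 1 (vec_lambda (y(i := t))))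
    = n * (n - 1) * (t + \<sigma> / n)\<^sup>2 - ((\<Sum>j\<in>UNIV - {i}. (y j)\<^sup>2) - \<sigma>\<^sup>2 / n)"
proof -
  define \<rho> where "\<rho> = (\<Sum>j\<in>UNIV - {i}. (y j)\<^sup>2)"
  have n: "n > 0" by (simp add: n_def)
  have card: "real (card (UNIV - {i} :: 'n set)) = n - 1"
    by (simp add: n_def card_Diff_singleton of_nat_diff Suc_le_eq)
  have "shear i (UNIV - {i}) 1 (vec_lambda (y(i := t))) = vec_lambda ((\<lambda>j. y j + t)(i := t))"
    by (auto simp: shear_def vec_eq_iff)
  then have "fpoly (shear i (UNIV - {i}) 1 (vec_lambda (y(i := t))))
     = 2 * (\<Sum>j\<in>UNIV - {i}. y j + t) * t + ((\<Sum>j\<in>UNIV - {i}. y j + t)\<^sup>2 - (\<Sum>j\<in>UNIV - {i}. (y j + t)\<^sup>2))"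
    by (simp only: fpoly_slice)
  also have "(\<Sum>j\<in>UNIV - {i}. y j + t) = \<sigma> + (n - 1) * t"
    by (simp only: sum.distrib sum_constant card \<sigma>_def)
  also have "(\<Sum>j\<in>UNIV - {i}. (y j + t)\<^sup>2) = \<rho> + 2 * \<sigma> * t + (n - 1) * t\<^sup>2"
    by (simp only: power2_sum sum.distrib sum_constant card \<sigma>_def \<rho>_def sum_distrib_left[symmetric]
         sum_distrib_right[symmetric] mult.assoc)
  also have "2 * (\<sigma> + (n - 1) * t) * t + ((\<sigma> + (n - 1) * t)\<^sup>2 - (\<rho> + 2 * \<sigma> * t + (n - 1) * t\<^sup>2))
     = n * (n - 1) * (t + \<sigma> / n)\<^sup>2 - (\<rho> - \<sigma>\<^sup>2 / n)"
    using n by (simp add: power2_eq_square field_simps)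
  finally show ?thesis by (simp only: \<rho>_def)
qed

text \<open>
  The difference of the square roots is the difference of the radicands divided by the sum of the
  roots, and that sum is at least \<open>sqrt (q / c)\<close>.
\<close>

lemma slice_quadratic_length_le:
  fixes c q \<epsilon> :: real
  assumes "c > 0" "q > 0" "\<epsilon> > 0"
  shows "2 * (sqrt ((q + \<epsilon>) / c) - sqrt (max 0 ((q - \<epsilon>) / c))) \<le> \<epsilon> * (4 / (c * sqrt (q / c)))"
proof -
  define A where "A = sqrt (max 0 ((q - \<epsilon>) / c))"
  define B where "B = sqrt ((q + \<epsilon>) / c)"
  define S where "S = sqrt (q / c)"
  have "S > 0" using assms by (simp add: S_def)
  have "S \<le> B" "A \<le> B" "0 \<le> A"
    using assms by (auto simp: A_def B_def S_def divide_right_mono)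
  then have "(B - A) * S \<le> (B - A) * (B + A)" by (intro mult_left_mono) auto
  also have "\<dots> = B\<^sup>2 - A\<^sup>2" by (simp add: power2_eq_square algebra_simps)
  also have "\<dots> = (q + \<epsilon>) / c - max 0 ((q - \<epsilon>) / c)"
    using assms by (simp add: A_def B_def)
  also have "\<dots> \<le> (q + \<epsilon>) / c - (q - \<epsilon>) / c" by simp
  also have "\<dots> = 2 * \<epsilon> / c" by (simp add: diff_divide_distrib[symmetric])
  finally have "B - A \<le> 2 * \<epsilon> / c / S"
    using \<open>S > 0\<close> by (simp only: pos_le_divide_eq)
  then have "2 * (B - A) \<le> 2 * (2 * \<epsilon> / c / S)" by simp
  also have "\<dots> = \<epsilon> * (4 / (c * S))" by simp
  finally show ?thesis by (simp only: A_def B_def S_def)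
qed

lemma slice_quadratic_length_limit:
  fixes c q :: real
  assumes "c > 0" "q > 0"
  shows "((\<lambda>\<epsilon>. 2 * (sqrt ((q + \<epsilon>) / c) - sqrt (max 0 ((q - \<epsilon>) / c))) / \<epsilon>)
    \<longlongrightarrow> 2 / (c * sqrt (q / c))) (at_right 0)"
proof -
  define u where "u = q / c"
  define v where "v = 1 / c"
  have uv: "u > 0" "v > 0" using assms by (auto simp: u_def v_def)
  have "((\<lambda>\<epsilon>. 2 * (sqrt (u + \<epsilon> * v) - sqrt (u - \<epsilon> * v)) / \<epsilon>)
      \<longlongrightarrow> 2 * (v * (inverse u * u powr (1 / 2)))) (at_right 0)"
    using uv by real_asymp
  moreover have "inverse u * u powr (1 / 2) = 1 / sqrt u"
    using uv by (simp add: powr_half_sqrt divide_simps)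
  ultimately have "((\<lambda>\<epsilon>. 2 * (sqrt (u + \<epsilon> * v) - sqrt (u - \<epsilon> * v)) / \<epsilon>) \<longlongrightarrow> 2 * v / sqrt u) (at_right 0)"
    by simp
  then have lim: "((\<lambda>\<epsilon>. 2 * (sqrt (u + \<epsilon> * v) - sqrt (u - \<epsilon> * v)) / \<epsilon>) \<longlongrightarrow> 2 / (c * sqrt (q / c))) (at_right 0)"
    by (simp add: u_def v_def)
  have "\<forall>\<^sub>F \<epsilon> in at_right 0. 2 * (sqrt (u + \<epsilon> * v) - sqrt (u - \<epsilon> * v)) / \<epsilon>
      = 2 * (sqrt ((q + \<epsilon>) / c) - sqrt (max 0 ((q - \<epsilon>) / c))) / \<epsilon>"
    using eventually_at_right_real[OF assms(2)]
    by eventually_elim (use assms in \<open>auto simp: u_def v_def add_divide_distrib diff_divide_distrib max_def divide_right_mono\<close>)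
  with lim show ?thesis by (rule Lim_transform_eventually)
qed

text \<open>
  The Euclidean norm dominates every \<open>\<bar>y j\<bar>\<close>, hence their geometric mean.  This bounds the
  inverse of the norm by a product of functions of one variable, which is integrable near the origin
  as soon as the exponent \<open>-1 / card I\<close> exceeds \<open>-1\<close>.
\<close>

lemma inverse_sqrt_sum_squares_le_prod:
  fixes y :: "'i \<Rightarrow> real"
  assumes "finite I" "I \<noteq> {}" "\<And>j. j \<in> I \<Longrightarrow> y j \<noteq> 0"
  shows "1 / sqrt (\<Sum>j\<in>I. (y j)\<^sup>2) \<le> (\<Prod>j\<in>I. \<bar>y j\<bar> powr (- 1 / card I))"
proof -
  define R where "R = sqrt (\<Sum>j\<in>I. (y j)\<^sup>2)"
  have card: "card I > 0" using assms by (simp add: card_gt_0_iff)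
  have le: "\<bar>y j\<bar> \<le> R" if "j \<in> I" for j
    unfolding R_def using assms that by (intro real_le_rsqrt) (auto intro: member_le_sum)
  obtain j where "j \<in> I" using assms by auto
  with le assms have "R > 0" by (metis less_le_trans zero_less_abs_iff)
  have "1 / R = R powr (card I * (- 1 / card I))"
    using card \<open>R > 0\<close> by (simp add: powr_minus_divide)
  also have "\<dots> = (\<Prod>j\<in>I. R powr (- 1 / card I))"
    using \<open>R > 0\<close> by (subst powr_power[symmetric]) auto
  also have "\<dots> \<le> (\<Prod>j\<in>I. \<bar>y j\<bar> powr (- 1 / card I))"
    using le assms by (intro prod_mono conjI powr_mono2') auto
  finally show ?thesis by (simp add: R_def)
qed

lemma AE_PiM_lborel_nonzero:
  assumes "finite I"
  shows "AE y in PiM I (\<lambda>_. lborel :: real measure). \<forall>j\<in>I. y j \<noteq> 0"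
proof (rule AE_finite_allI[OF assms])
  fix j assume j: "j \<in> I"
  let ?N = "PiE I (\<lambda>k. if k = j then {0} else UNIV)"
  have "emeasure (PiM I (\<lambda>_. lborel :: real measure)) ?N = (\<Prod>k\<in>I. emeasure lborel (if k = j then {0} else (UNIV :: real set)))"
    by (rule lebesgue_factors.emeasure_PiM[OF assms]) auto
  also have "\<dots> = 0" using assms j by (intro prod_zero) auto
  finally have N: "?N \<in> null_sets (PiM I (\<lambda>_. lborel :: real measure))"
    using assms by (intro null_setsI sets_PiM_I_finite) auto
  show "AE y in PiM I (\<lambda>_. lborel :: real measure). y j \<noteq> 0"
    by (rule AE_I'[OF N]) (auto simp: space_PiM PiE_iff extensional_def)
qed

text \<open>
  The slices along \<open>(1, \<dots>, 1)\<close> through \<open>y\<close> have length about \<open>2 * \<epsilon> / sqrt (c * q y)\<close>, where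
  \<open>q\<close> is a positive definite form in \<open>n - 1\<close> variables.  The singularity of this function at the
  origin is integrable because \<open>n - 1 \<ge> 2\<close>, so the volume is still of order \<open>\<epsilon>\<close>.
\<close>

lemma small_volume_pair_fpoly_zero:
  fixes e :: real
  assumes card: "CARD('n::finite) \<ge> 3" and "e > 0"
  shows "\<exists>V. open V \<and> (0 :: real ^ 'n) \<in> V \<and> V \<subseteq> ball 0 e \<and> volume_pair fpoly V (1, 1)"
proof -
  obtain i :: 'n where True by simp
  define J where "J = UNIV - {i}"
  define n where "n = real CARD('n)"
  have n: "n \<ge> 3" using card by (simp add: n_def)
  have cardJ: "real (card J) = n - 1"
    by (simp add: n_def J_def card_Diff_singleton of_nat_diff Suc_le_eq)
  define c where "c = n * (n - 1)"
  have c: "c > 0" "c \<ge> 2 * n" using n by (simp_all add: c_def)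
  \<comment> \<open>The shear at most doubles the largest absolute value of a coordinate, so the box of
    half-width \<open>r\<close> is mapped into \<open>ball 0 e\<close>.  The constants \<open>\<eta>\<close> and \<open>\<delta>\<close> are such that
    \<open>q \<le> n * \<eta>\<^sup>2\<close> and \<open>\<bar>p x\<bar> < \<delta>\<close> imply \<open>\<bar>t + \<sigma> / n\<bar> < \<eta>\<close>, hence
    \<open>\<bar>t\<bar> < 2 * \<eta>\<close>.\<close>
  define r where "r = e / (2 * n)"
  define \<eta> where "\<eta> = r / 3"
  define \<delta> where "\<delta> = n * \<eta>\<^sup>2"
  have pos: "r > 0" "\<eta> > 0" "\<delta> > 0" using n assms by (simp_all add: r_def \<eta>_def \<delta>_def)
  define \<sigma> where "\<sigma> y = (\<Sum>j\<in>J. y j)" for y :: "'n \<Rightarrow> real"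
  define \<rho> where "\<rho> y = (\<Sum>j\<in>J. (y j)\<^sup>2)" for y :: "'n \<Rightarrow> real"
  define q where "q y = \<rho> y - (\<sigma> y)\<^sup>2 / n" for y
  define p :: "real ^ 'n \<Rightarrow> real" where "p x = fpoly (shear i J 1 x)" for x
  have p_slice: "p (vec_lambda (y(i := t))) = c * (t + \<sigma> y / n)\<^sup>2 - q y" for y t
    unfolding p_def J_def fpoly_shear_slice c_def n_def q_def \<rho>_def \<sigma>_def ..
  have p: "continuous_on UNIV p"
    unfolding p_def
    by (intro continuous_on_compose2[OF continuous_on_fpoly[of UNIV]] continuous_on_shear) auto
  have \<rho>0: "\<rho> y \<ge> 0" for y unfolding \<rho>_def by (intro sum_nonneg) auto
  \<comment> \<open>Positive definiteness of \<open>q\<close>: by Cauchy-Schwarz on the \<open>n - 1\<close> terms of \<open>\<sigma>\<close>.\<close>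
  have q_ge: "\<rho> y / n \<le> q y" for y
  proof -
    have "(\<sigma> y)\<^sup>2 \<le> \<rho> y * (n - 1)"
      using sum_squared_le_sum_of_squares[of y J] by (simp add: \<sigma>_def \<rho>_def cardJ)
    then have "(\<sigma> y)\<^sup>2 / n \<le> \<rho> y * (n - 1) / n" using n by (intro divide_right_mono) auto
    also have "\<dots> = \<rho> y - \<rho> y / n" using n by (simp add: field_simps)
    finally show ?thesis by (simp add: q_def)
  qed
  have q0: "q y \<ge> 0" for y
  proof -
    have "0 \<le> \<rho> y / n" using n \<rho>0[of y] by simp
    also note q_ge
    finally show ?thesis .
  qed
  have q_le: "q y \<le> n * \<eta>\<^sup>2" and \<sigma>_le: "\<bar>\<sigma> y / n\<bar> \<le> \<eta>"
    if y: "\<And>j. j \<in> J \<Longrightarrow> \<bar>y j\<bar> < \<eta>" for y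
  proof -
    have "\<rho> y \<le> card J * \<eta>\<^sup>2"
      unfolding \<rho>_def
    proof (rule sum_bounded_above)
      fix j assume "j \<in> J"
      with y[of j] pos show "(y j)\<^sup>2 \<le> \<eta>\<^sup>2" by (intro abs_le_square_iff[THEN iffD1]) simp
    qed
    also have "\<dots> \<le> n * \<eta>\<^sup>2" by (simp add: cardJ mult_right_mono)
    finally have "\<rho> y \<le> n * \<eta>\<^sup>2" .
    moreover have "(\<sigma> y)\<^sup>2 / n \<ge> 0" using n by simp
    ultimately show "q y \<le> n * \<eta>\<^sup>2" unfolding q_def by linarith
    have "\<bar>\<sigma> y\<bar> \<le> (\<Sum>j\<in>J. \<bar>y j\<bar>)" unfolding \<sigma>_def by (rule sum_abs)
    also have "\<dots> \<le> card J * \<eta>" using y by (intro sum_bounded_above) (simp add: less_imp_le)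
    also have "\<dots> \<le> n * \<eta>" using pos by (simp add: cardJ mult_right_mono)
    finally show "\<bar>\<sigma> y / n\<bar> \<le> \<eta>" using n by (simp add: field_simps)
  qed
  define V where "V = {x. (\<forall>j. j \<noteq> i \<longrightarrow> \<bar>x $ j - (0 :: real ^ 'n) $ j\<bar> < \<eta>) \<and> \<bar>p x\<bar> < \<delta>}"
  have "open V" unfolding V_def by (rule open_box_sublevel[OF p])
  have V_small: "\<bar>x $ j\<bar> < r" if x: "x \<in> V" for x j
  proof (cases "j = i")
    case True
    have xj: "\<bar>x $ j\<bar> < \<eta>" if "j \<in> J" for j
      using x that by (simp add: V_def J_def)
    have "vec_lambda ((($) x)(i := x $ i)) = x" by (simp add: vec_eq_iff)
    then have "p x = c * (x $ i + \<sigma> (($) x) / n)\<^sup>2 - q (($) x)"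
      using p_slice[of "($) x" "x $ i"] by simp
    then have "c * (x $ i + \<sigma> (($) x) / n)\<^sup>2 < \<delta> + q (($) x)"
      using x by (auto simp: V_def)
    also have "\<dots> \<le> 2 * n * \<eta>\<^sup>2" using q_le[of "($) x", OF xj] by (simp add: \<delta>_def)
    also have "\<dots> \<le> c * \<eta>\<^sup>2" using c by (intro mult_right_mono) auto
    finally have "(x $ i + \<sigma> (($) x) / n)\<^sup>2 < \<eta>\<^sup>2"
      by (simp only: mult_less_cancel_left_pos[OF c(1)])
    then have "\<bar>x $ i + \<sigma> (($) x) / n\<bar>\<^sup>2 < \<eta>\<^sup>2" by (simp only: power2_abs)
    then have "\<bar>x $ i + \<sigma> (($) x) / n\<bar> < \<eta>"
      by (rule power2_less_imp_less) (use pos in simp)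
    moreover have "\<bar>\<sigma> (($) x) / n\<bar> \<le> \<eta>" by (rule \<sigma>_le) (rule xj)
    ultimately show ?thesis using pos unfolding \<eta>_def True by linarith
  next
    case False
    with x pos show ?thesis by (auto simp: V_def \<eta>_def dest!: spec[of _ j])
  qed
  have "volume_pair p V (1, 1)"
    unfolding V_def
  proof (rule volume_pair_1_1_if_slices[where
        len = "\<lambda>\<epsilon> y. 2 * (sqrt ((q y + \<epsilon>) / c) - sqrt (max 0 ((q y - \<epsilon>) / c)))"
        and k = "\<lambda>y. 4 * sqrt (n * c) / c * (\<Prod>j\<in>J. \<bar>y j\<bar> powr (- 1 / card J))"
        and h = "\<lambda>y. 2 / (c * sqrt (q y / c))" and c = "2 / (c * sqrt (n * \<eta>\<^sup>2 / c))"],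
      unfold J_def[symmetric])
    let ?P = "PiM J (\<lambda>_. lborel :: real measure)"
    let ?Q = "PiE J (\<lambda>j. {(0 :: real ^ 'n) $ j - \<eta><..<(0 :: real ^ 'n) $ j + \<eta>})"
    let ?len = "\<lambda>\<epsilon> y. 2 * (sqrt ((q y + \<epsilon>) / c) - sqrt (max 0 ((q y - \<epsilon>) / c)))"
    let ?k = "\<lambda>y. 4 * sqrt (n * c) / c * (\<Prod>j\<in>J. \<bar>y j\<bar> powr (- 1 / card J))"
    have Q: "\<bar>y j\<bar> < \<eta>" if "y \<in> ?Q" "j \<in> J" for y j
    proof -
      have "y j \<in> {0 - \<eta><..<0 + \<eta>}" using that by (auto simp: PiE_iff)
      then show ?thesis by auto
    qed
    show "2 / (c * sqrt (n * \<eta>\<^sup>2 / c)) > 0" using n c pos by simp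
    show "emeasure lborel {t. \<bar>p (vec_lambda (y(i := t)))\<bar> \<le> \<epsilon>} = ennreal (?len \<epsilon> y)"
      if "0 < \<epsilon>" for y \<epsilon>
      unfolding p_slice using emeasure_slice_quadratic[OF c(1) that q0] .
    have [measurable]: "q \<in> borel_measurable ?P"
      unfolding q_def \<rho>_def \<sigma>_def by measurable
    show "?len \<epsilon> \<in> borel_measurable ?P" for \<epsilon> by measurable
    show "(\<lambda>y. 2 / (c * sqrt (q y / c))) \<in> borel_measurable ?P" by measurable
    show "0 \<le> ?len \<epsilon> y" if "0 < \<epsilon>" for y \<epsilon>
      using that c q0[of y] by (auto simp: divide_right_mono)
    have nonzero: "AE y in ?P. \<forall>j\<in>J. y j \<noteq> 0"
      by (rule AE_PiM_lborel_nonzero) (simp add: J_def)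
    have J: "finite J" "J \<noteq> {}" using cardJ n by auto
    have \<rho>_pos: "\<rho> y > 0" if "\<forall>j\<in>J. y j \<noteq> 0" for y
      unfolding \<rho>_def using that J by (intro sum_pos) auto
    have q_pos: "q y > 0" if "\<forall>j\<in>J. y j \<noteq> 0" for y
    proof -
      have "0 < \<rho> y / n" using \<rho>_pos[OF that] n by simp
      also note q_ge
      finally show ?thesis .
    qed
    show "AE y in ?P. y \<in> ?Q \<longrightarrow> (\<forall>\<epsilon>\<in>{0<..<\<delta>}. ?len \<epsilon> y \<le> \<epsilon> * ?k y)"
      using nonzero
    proof eventually_elim
      case (elim y)
      have "sqrt (\<rho> y) / sqrt (n * c) = sqrt (\<rho> y / n / c)" by (simp add: real_sqrt_divide)
      also have "\<dots> \<le> sqrt (q y / c)" using q_ge[of y] c by (intro real_sqrt_le_mono divide_right_mono) simp_all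
      finally have "4 / (c * sqrt (q y / c)) \<le> 4 / (c * (sqrt (\<rho> y) / sqrt (n * c)))"
        using c n \<rho>_pos[OF elim] by (intro divide_left_mono mult_left_mono mult_pos_pos) (auto simp: q_pos[OF elim])
      also have "\<dots> = 4 * sqrt (n * c) / c * (1 / sqrt (\<rho> y))" by simp
      also have "\<dots> \<le> ?k y"
        unfolding \<rho>_def using J elim c n by (intro mult_left_mono inverse_sqrt_sum_squares_le_prod) auto
      finally have k: "4 / (c * sqrt (q y / c)) \<le> ?k y" .
      show ?case
      proof (intro impI ballI)
        fix \<epsilon> assume "\<epsilon> \<in> {0<..<\<delta>}"
        then have "\<epsilon> > 0" by simp
        have "?len \<epsilon> y \<le> \<epsilon> * (4 / (c * sqrt (q y / c)))"
          by (rule slice_quadratic_length_le[OF c(1) q_pos[OF elim] \<open>\<epsilon> > 0\<close>])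
        also have "\<dots> \<le> \<epsilon> * ?k y" using k \<open>\<epsilon> > 0\<close> by (intro mult_left_mono) auto
        finally show "?len \<epsilon> y \<le> \<epsilon> * ?k y" .
      qed
    qed
    show "integrable ?P (\<lambda>y. indicator ?Q y * ?k y)"
    proof -
      let ?f = "\<lambda>t. indicator {- \<eta><..<\<eta>} t * \<bar>t\<bar> powr (- 1 / card J)"
      have "- 1 / real (card J) > - 1" using n by (simp add: cardJ)
      then have "integrable ?P (\<lambda>y. \<Prod>j\<in>J. ?f (y j))"
        using J pos by (intro lebesgue_factors.product_integrable_prod integrable_abs_powr) auto
      then have "integrable ?P (\<lambda>y. 4 * sqrt (n * c) / c * (\<Prod>j\<in>J. ?f (y j)))"
        by (rule integrable_mult_right)
      also have "?this \<longleftrightarrow> ?thesis"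
      proof (rule Bochner_Integration.integrable_cong[OF refl])
        fix y assume "y \<in> space ?P"
        then have "indicator ?Q y = (\<Prod>j\<in>J. indicator {- \<eta><..<\<eta>} (y j) :: real)"
          using J by (auto simp: indicator_def space_PiM PiE_iff prod_zero_iff)
        then show "4 * sqrt (n * c) / c * (\<Prod>j\<in>J. ?f (y j)) = indicator ?Q y * ?k y"
          by (simp add: prod.distrib)
      qed
      finally show ?thesis .
    qed
    show "AE y in ?P. y \<in> ?Q \<longrightarrow> ((\<lambda>\<epsilon>. ?len \<epsilon> y / \<epsilon>) \<longlongrightarrow> 2 / (c * sqrt (q y / c))) (at_right 0) \<and>
        2 / (c * sqrt (n * \<eta>\<^sup>2 / c)) \<le> 2 / (c * sqrt (q y / c))"
      using nonzero
    proof eventually_elim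
      case (elim y)
      have "2 / (c * sqrt (n * \<eta>\<^sup>2 / c)) \<le> 2 / (c * sqrt (q y / c))" if "y \<in> ?Q"
        using q_le[of y] Q[OF that] c n pos q_pos[OF elim]
        by (intro divide_left_mono mult_left_mono mult_pos_pos real_sqrt_le_mono divide_right_mono) auto
      then show ?case using slice_quadratic_length_limit[OF c(1) q_pos[OF elim]] by blast
    qed
  qed (use pos p in auto)
  then have "volume_pair fpoly (shear i J (- 1) -` V) (1, 1)"
    unfolding p_def by (intro volume_pair_shear continuous_on_fpoly \<open>open V\<close>) (auto simp: J_def)
  moreover have "open (shear i J (- 1) -` V)"
    by (intro open_vimage \<open>open V\<close> continuous_on_shear)
  moreover have "shear i J (- 1) -` V \<subseteq> ball 0 e"
  proof
    fix x assume x: "x \<in> shear i J (- 1) -` V"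
    define z where "z = shear i J (- 1) x"
    have z: "\<bar>z $ j\<bar> < r" for j using V_small x by (simp add: z_def)
    have "i \<notin> J" by (simp add: J_def)
    then have xz: "x = shear i J 1 z" by (simp add: z_def shear_inverse)
    have "\<bar>x $ j\<bar> < 2 * r" for j
      using z[of i] z[of j] pos unfolding xz shear_def by auto
    from norm_less_if_components_less[OF this] n show "x \<in> ball 0 e"
      by (simp add: r_def n_def)
  qed
  moreover have "0 \<in> shear i J (- 1) -` V"
  proof -
    have "shear i J b 0 = 0" for b by (simp add: shear_def vec_eq_iff)
    then show ?thesis using pos by (simp add: V_def p_def fpoly_def)
  qed
  ultimately show ?thesis by blast
qed

section \<open>The origin in dimension two\<close>

text \<open>
  Here the values are the lengths of the slices of \<open>\<bar>2 * u * t\<bar> \<le> \<epsilon>\<close> in a square of side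
  \<open>2 * r\<close>.  The inverse of \<open>\<bar>u\<bar>\<close> is not integrable at \<open>0\<close>; cutting it off at distance
  \<open>\<epsilon> / (2 * r)\<close>, where the slices reach the boundary of the square, leaves a logarithm.
\<close>

lemma has_integral_truncated_inverse:
  fixes r \<epsilon> :: real
  assumes "0 < \<epsilon>" "\<epsilon> < 2 * r\<^sup>2" "r > 0"
  shows "((\<lambda>u. if \<bar>u\<bar> \<le> \<epsilon> / (2 * r) then 2 * r else \<epsilon> / \<bar>u\<bar>)
    has_integral (2 * \<epsilon> * (1 + ln (2 * r\<^sup>2) - ln \<epsilon>))) {- r..r}"
proof -
  define s where "s = \<epsilon> / (2 * r)"
  have s: "0 < s" "s < r" "\<epsilon> = 2 * r * s"
    using assms by (simp_all add: s_def field_simps power2_eq_square)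
  let ?g = "\<lambda>u. if \<bar>u\<bar> \<le> s then 2 * r else \<epsilon> / \<bar>u\<bar>"
  have "((\<lambda>u. \<epsilon> / u) has_integral (\<epsilon> * ln r - \<epsilon> * ln s)) {s..r}"
    using s by (intro fundamental_theorem_of_calculus)
      (auto intro!: derivative_eq_intros simp flip: has_real_derivative_iff_has_vector_derivative)
  then have right: "(?g has_integral (\<epsilon> * ln r - \<epsilon> * ln s)) {s..r}"
    using s by (subst has_integral_cong[where g = "\<lambda>u. \<epsilon> / u"]) auto
  have left: "(?g has_integral (\<epsilon> * ln r - \<epsilon> * ln s)) {- r..- s}"
    using has_integral_reflect_lemma_real[OF right] by (simp cong: if_cong)
  have "((\<lambda>_. 2 * r) has_integral (2 * \<epsilon>)) {- s..s}"
    using has_integral_const_real[of "2 * r" "- s" s] s by (simp add: mult.commute mult.left_commute)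
  then have middle: "(?g has_integral (2 * \<epsilon>)) {- s..s}"
    by (subst has_integral_cong[where g = "\<lambda>_. 2 * r"]) auto
  have "(?g has_integral (\<epsilon> * ln r - \<epsilon> * ln s) + 2 * \<epsilon>) {- r..s}"
    using s by (intro has_integral_combine[OF _ _ left middle]) auto
  then have "(?g has_integral (\<epsilon> * ln r - \<epsilon> * ln s) + 2 * \<epsilon> + (\<epsilon> * ln r - \<epsilon> * ln s)) {- r..r}"
    using s by (intro has_integral_combine[OF _ _ _ right]) auto
  moreover have "(\<epsilon> * ln r - \<epsilon> * ln s) + 2 * \<epsilon> + (\<epsilon> * ln r - \<epsilon> * ln s) = 2 * \<epsilon> * (1 + ln (2 * r\<^sup>2) - ln \<epsilon>)"
  proof -
    have ln_s: "ln s = ln \<epsilon> - ln (2 * r)" using assms by (simp add: s_def ln_div)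
    have ln_r: "ln (2 * r\<^sup>2) = ln (2 * r) + ln r"
      using assms by (simp add: power2_eq_square ln_mult)
    show ?thesis unfolding ln_s ln_r by (simp add: algebra_simps)
  qed
  ultimately show ?thesis by (simp only: s_def)
qed

text \<open>
  In two variables the form is \<open>2 * x * y\<close>, and the volume in a square can be computed exactly.
\<close>

lemma small_volume_pair_fpoly_zero_plane:
  fixes e :: real
  assumes card: "CARD('n::finite) = 2" and "e > 0"
  shows "\<exists>V. open V \<and> (0 :: real ^ 'n) \<in> V \<and> V \<subseteq> ball 0 e \<and> volume_pair fpoly V (1, 2)"
proof -
  obtain i j :: 'n where ij: "UNIV = {i, j}" "i \<noteq> j" using card by (auto simp: card_2_iff)
  have rest: "UNIV - {i} = {j}" using ij by auto
  define r where "r = e / 2"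
  have r: "r > 0" using assms by (simp add: r_def)
  define V :: "(real ^ 'n) set" where "V = {x. \<forall>k. \<bar>x $ k\<bar> < r}"
  have "V = (\<Inter>k. {x. \<bar>x $ k\<bar> < r})" by (auto simp: V_def)
  moreover have "open {x :: real ^ 'n. \<bar>x $ k\<bar> < r}" for k
    by (intro open_Collect_less continuous_intros)
  ultimately have "open V" by (simp add: open_INT)
  have V_small: "V \<subseteq> ball 0 e"
  proof
    fix x assume "x \<in> V"
    then have "\<bar>x $ k\<bar> < r" for k by (simp add: V_def)
    from norm_less_if_components_less[OF this] show "x \<in> ball 0 e" by (simp add: card r_def)
  qed
  let ?g = "\<lambda>\<epsilon> u. if \<bar>u\<bar> \<le> \<epsilon> / (2 * r) then 2 * r else \<epsilon> / \<bar>u\<bar>"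
  have volume: "sublevel_volume fpoly V \<epsilon> = 2 * \<epsilon> * (1 + ln (2 * r\<^sup>2) - ln \<epsilon>)"
    if \<epsilon>: "0 < \<epsilon>" "\<epsilon> < 2 * r\<^sup>2" for \<epsilon>
  proof -
    let ?A = "{w \<in> V. \<bar>fpoly w\<bar> \<le> \<epsilon>}"
    have [measurable]: "(fpoly :: real ^ 'n \<Rightarrow> real) \<in> borel_measurable borel" "V \<in> sets borel"
      using \<open>open V\<close> by (auto intro: borel_measurable_continuous_onI continuous_on_fpoly)
    have A: "?A \<in> sets borel" by measurable
    have slice: "emeasure lborel {t. vec_lambda (y(i := t)) \<in> ?A} = ennreal (indicator {- r<..<r} (y j) * ?g \<epsilon> (y j))" for y
    proof (cases "\<bar>y j\<bar> < r")
      case True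
      have all: "(\<forall>k. \<bar>(y(i := t)) k\<bar> < r) \<longleftrightarrow> \<bar>t\<bar> < r" for t
      proof -
        have "(\<forall>k. \<bar>(y(i := t)) k\<bar> < r) \<longleftrightarrow> (\<forall>k\<in>{i, j}. \<bar>(y(i := t)) k\<bar> < r)"
          by (simp add: ij(1)[symmetric])
        then show ?thesis using True ij(2) by simp
      qed
      have f: "fpoly (vec_lambda (y(i := t))) = 2 * y j * t" for t
        by (simp add: fpoly_slice rest)
      have set: "{t. vec_lambda (y(i := t)) \<in> ?A} = {t. \<bar>t\<bar> < r \<and> \<bar>2 * y j * t\<bar> \<le> \<epsilon>}"
        unfolding V_def mem_Collect_eq f vec_lambda_beta all ..
      show ?thesis
      proof (cases "\<bar>y j\<bar> \<le> \<epsilon> / (2 * r)")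
        case small: True
        have "\<bar>2 * y j * t\<bar> \<le> \<epsilon>" if "\<bar>t\<bar> < r" for t
        proof -
          have "\<bar>y j\<bar> * \<bar>t\<bar> \<le> \<epsilon> / (2 * r) * r"
            using that small \<epsilon> r by (intro mult_mono) auto
          then show ?thesis using r by (simp add: abs_mult)
        qed
        then have "{t. \<bar>t\<bar> < r \<and> \<bar>2 * y j * t\<bar> \<le> \<epsilon>} = {- r<..<r}" by auto
        then show ?thesis unfolding set using True small r by (simp add: indicator_def abs_less_iff)
      next
        case large: False
        have pos: "\<bar>y j\<bar> > 0" using large \<epsilon> r by (smt (verit) divide_pos_pos)
        have "\<bar>t\<bar> < r" if "\<bar>2 * y j * t\<bar> \<le> \<epsilon>" for t
        proof -
          have "2 * \<bar>y j\<bar> * \<bar>t\<bar> < 2 * \<bar>y j\<bar> * r"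
            using that large r by (simp add: abs_mult field_simps)
          then show ?thesis using pos by simp
        qed
        then have "{t. \<bar>t\<bar> < r \<and> \<bar>2 * y j * t\<bar> \<le> \<epsilon>} = {t. \<bar>2 * y j * t + 0\<bar> \<le> \<epsilon>}" by auto
        moreover have "emeasure lborel \<dots> = ennreal (2 * \<epsilon> / \<bar>2 * y j\<bar>)"
          using pos \<epsilon> by (intro emeasure_slice_affine) auto
        ultimately show ?thesis
          unfolding set using True large by (simp add: indicator_def abs_less_iff abs_mult)
      qed
    next
      case False
      then have "vec_lambda (y(i := t)) \<notin> V" for t
        using ij(2) by (auto simp: V_def intro!: exI[of _ j])
      then have empty: "{t. vec_lambda (y(i := t)) \<in> ?A} = {}" by simp
      have "y j \<notin> {- r<..<r}" using False by auto
      then show ?thesis unfolding empty by simp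
    qed
    have [measurable]: "(\<lambda>u. indicator {- r<..<r} u * ?g \<epsilon> u) \<in> borel_measurable borel" by measurable
    have "emeasure lborel ?A = (\<integral>\<^sup>+y. ennreal (indicator {- r<..<r} (y j) * ?g \<epsilon> (y j)) \<partial>PiM {j} (\<lambda>_. lborel))"
      unfolding emeasure_lborel_slices[OF A, of i] slice rest ..
    also have "\<dots> = (\<integral>\<^sup>+u. ennreal (indicator {- r<..<r} u * ?g \<epsilon> u) \<partial>lborel)"
      by (rule lebesgue_factors.product_nn_integral_singleton) measurable
    also have "\<dots> = ennreal (2 * \<epsilon> * (1 + ln (2 * r\<^sup>2) - ln \<epsilon>))"
    proof (rule nn_integral_has_integral_lborel)
      have "(?g \<epsilon> has_integral (2 * \<epsilon> * (1 + ln (2 * r\<^sup>2) - ln \<epsilon>))) {- r<..<r}"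
        using has_integral_truncated_inverse[OF \<epsilon> r] by (simp only: has_integral_Icc_iff_Ioo)
      also have "?this \<longleftrightarrow> ((\<lambda>u. if u \<in> {- r<..<r} then ?g \<epsilon> u else 0)
          has_integral (2 * \<epsilon> * (1 + ln (2 * r\<^sup>2) - ln \<epsilon>))) UNIV"
        by (rule has_integral_restrict_UNIV[symmetric])
      also have "(\<lambda>u. if u \<in> {- r<..<r} then ?g \<epsilon> u else 0) = (\<lambda>u. indicator {- r<..<r} u * ?g \<epsilon> u)"
        by (auto simp: indicator_def)
      finally show "((\<lambda>u. indicator {- r<..<r} u * ?g \<epsilon> u)
          has_integral (2 * \<epsilon> * (1 + ln (2 * r\<^sup>2) - ln \<epsilon>))) UNIV" .
    qed (use \<epsilon> r in \<open>auto simp: indicator_def\<close>)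
    finally have "emeasure lborel ?A = ennreal (2 * \<epsilon> * (1 + ln (2 * r\<^sup>2) - ln \<epsilon>))" .
    moreover have "ln \<epsilon> < ln (2 * r\<^sup>2)" using \<epsilon> r by simp
    ultimately show ?thesis
      using \<epsilon> A by (simp add: sublevel_volume_def measure_def)
  qed
  have "2 * r\<^sup>2 > 0" using r by simp
  from eventually_at_right_real[OF this]
  have ev: "\<forall>\<^sub>F \<epsilon> in at_right 0. 2 * \<epsilon> * (1 + ln (2 * r\<^sup>2) - ln \<epsilon>) = sublevel_volume fpoly V \<epsilon>"
    by eventually_elim (use volume in auto)
  have "(\<lambda>\<epsilon>. 2 * \<epsilon> * (1 + b - ln \<epsilon>)) \<sim>[at_right 0] (\<lambda>\<epsilon>. 2 * \<epsilon> powr 1 * (- ln \<epsilon>) ^ 1)" for b :: real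
    by real_asymp
  from asymp_equiv_transfer[OF this ev]
  have "sublevel_volume fpoly V \<sim>[at_right 0] (\<lambda>\<epsilon>. 2 * \<epsilon> powr 1 * (- ln \<epsilon>) ^ (2 - 1))"
    by simp
  then have "volume_pair fpoly V (1, 2)"
    by (auto simp: volume_pair_def card intro!: exI[of _ 2])
  with \<open>open V\<close> V_small r show ?thesis by (auto simp: V_def intro!: exI[of _ V])
qed

section \<open>The real log canonical threshold\<close>

theorem theorem4p1:
  fixes a :: "real ^ 'n"
  assumes "CARD('n) \<ge> 2"
    and "fpoly a = 0"
  shows "has_RLCT fpoly a (if a = 0 \<and> CARD('n) = 2 then (1, 2) else (1, 1))"
proof (rule has_RLCT_if_arbitrarily_small[of fpoly a])
  fix e :: real
  assume "e > 0"
  consider "a \<noteq> 0" | "a = 0" "CARD('n) \<ge> 3" | "a = 0" "CARD('n) = 2"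
    using assms(1) by linarith
  then show "\<exists>V. open V \<and> a \<in> V \<and> V \<subseteq> ball a e \<and>
      volume_pair fpoly V (if a = 0 \<and> CARD('n) = 2 then (1, 2) else (1, 1))"
  proof cases
    case 1
    with small_volume_pair_fpoly_nonzero[OF assms(1) _ assms(2) \<open>e > 0\<close>] show ?thesis by simp
  next
    case 2
    with small_volume_pair_fpoly_zero[OF _ \<open>e > 0\<close>, where 'n = 'n] show ?thesis by simp
  next
    case 3
    with small_volume_pair_fpoly_zero_plane[OF _ \<open>e > 0\<close>, where 'n = 'n] show ?thesis by simp
  qed
qed (use assms fpoly_frequently_nonzero real_analytic_at_fpoly in auto)

end
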